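(* Let $n$ be a positive integer and let $\mathrm{Cov}(\boldsymbol{S}_n)$ be the set of covering relations of the strong Bruhat order $\boldsymbol{S}_n$ on the symmetric group $S_n$. Let $\mathrm{wt}:\mathrm{Cov}(\boldsymbol{S}_n)\to\mathbb{Z}[z]$ be defined by $$\mathrm{wt}(v\lessdot w)=1+b_{v\lessdot w}(2-z)+c_{v\lessdot w}z .$$ Then for any $w\in S_n$ we have $$m_{\mathrm{wt}}(w,w_0)=\left(\binom{n}{2}-\ell(w)\right)!\cdot\mathfrak{S}_w(1,\ldots,1),$$ where $\mathfrak{S}_w$ is the Schubert polynomial of $w$. In particular, $m_{\mathrm{wt}}(w,w_0)$ does not depend on $z$.
   Context: Permutations $v\in S_n$ are written in one-line notation $v=v_1v_2\cdots v_n$ with $v_i=v(i)$; $w_0=n\,(n-1)\cdots 2\,1$. $t_{ij}=(i\;j)$ is a transposition, so $vt_{ij}$ is obtained from $v$ by exchanging the entries in positions $i$ and $j$; $s_i=t_{i,i+1}$. $\ell(w)$ is the Coxeter length. The strong Bruhat order $\boldsymbol{S}_n$ is the partial order on $S_n$ with covering relations $v\lessdot w$ whenever $w=vt_{ij}$ for some $i<j$ and $\ell(w)=\ell(v)+1$. For a covering relation $v\lessdot w=vt_{ij}$ with $i<j$, define $b_{v\lessdot w}=\#\{i<k<j : v_k>v_j\}$ and $c_{v\lessdot w}=\#\{k>j : v_i<v_k<v_j\}$. Given a ring $R$ and a weight function $\mathrm{wt}:\mathrm{Cov}(\boldsymbol{S}_n)\to R$, the weight of a saturated chain $c=(u_1\lessdot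 u_2\lessdot\cdots\lessdot u_k)$ is $\mathrm{wt}(c)=\prod_{i=1}^{k-1}\mathrm{wt}(u_i\lessdot u_{i+1})$ (an empty product is $1$). For $v\le w$, $m_{\mathrm{wt}}(v,w)=\sum_{c}\mathrm{wt}(c)$, the sum over all saturated chains $c$ from $v$ to $w$. The Schubert polynomials $\mathfrak{S}_w(x_1,\ldots,x_n)$, $w\in S_n$, are defined recursively by $\mathfrak{S}_{w_0}=x_1^{n-1}x_2^{n-2}\cdots x_{n-2}^2x_{n-1}$ and $\mathfrak{S}_{ws_i}=N_i\mathfrak{S}_w$ whenever $\ell(ws_i)<\ell(w)$, where $N_i g=\dfrac{g(x_1,\ldots,x_n)-g(x_1,\ldots,x_{i+1},x_i,\ldots,x_n)}{x_i-x_{i+1}}$ (the second term has $x_i$ and $x_{i+1}$ exchanged). *)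

theory Defs
  imports
    "HOL-Library.Poly_Mapping"
    "HOL-Computational_Algebra.Polynomial"
    "HOL-Combinatorics.Permutations"
begin

section \<open>The symmetric group\<close>

text \<open>
  Elements of \<open>S\<^sub>n\<close> are the functions \<open>v :: nat \<Rightarrow> nat\<close> with \<open>v permutes {1..n}\<close>; the one-line
  notation of \<open>v\<close> is \<open>v 1, \<dots>, v n\<close>. Products are compositions, so \<open>v \<circ> transpose i j\<close> is \<open>v\<close> with
  the entries in positions \<open>i\<close> and \<open>j\<close> exchanged.
\<close>

abbreviation simple_refl :: "nat \<Rightarrow> nat \<Rightarrow> nat" where
  "simple_refl i \<equiv> transpose i (i + 1)"

definition longest_perm :: "nat \<Rightarrow> nat \<Rightarrow> nat" where
  "longest_perm n i = (if i \<in> {1..n} then n + 1 - i else i)"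

definition word_prod :: "nat list \<Rightarrow> nat \<Rightarrow> nat" where
  "word_prod is = foldr (\<lambda>i u. simple_refl i \<circ> u) is id"

definition coxeter_length :: "nat \<Rightarrow> (nat \<Rightarrow> nat) \<Rightarrow> nat" where
  "coxeter_length n w =
     (LEAST k. \<exists>is. set is \<subseteq> {1..<n} \<and> length is = k \<and> word_prod is = w)"


section \<open>Covering relations of the strong Bruhat order\<close>

definition bruhat_covers :: "nat \<Rightarrow> ((nat \<Rightarrow> nat) \<times> (nat \<Rightarrow> nat)) set" where
  "bruhat_covers n =
     {(v, w). v permutes {1..n} \<and>
        (\<exists>i j. 1 \<le> i \<and> i < j \<and> j \<le> n \<and> w = v \<circ> transpose i j) \<and>
        coxeter_length n w = coxeter_length n v + 1}"

text \<open>The positions \<open>i < j\<close> with \<open>w = v t\<^sub>i\<^sub>j\<close>; they are unique if they exist.\<close>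

definition cover_positions :: "(nat \<Rightarrow> nat) \<times> (nat \<Rightarrow> nat) \<Rightarrow> nat \<times> nat" where
  "cover_positions e = (THE (i, j). i < j \<and> snd e = fst e \<circ> transpose i j)"

definition cover_b :: "(nat \<Rightarrow> nat) \<times> (nat \<Rightarrow> nat) \<Rightarrow> nat" where
  "cover_b e =
     (let v = fst e; (i, j) = cover_positions e
      in card {k. i < k \<and> k < j \<and> v k > v j})"

definition cover_c :: "nat \<Rightarrow> (nat \<Rightarrow> nat) \<times> (nat \<Rightarrow> nat) \<Rightarrow> nat" where
  "cover_c n e =
     (let v = fst e; (i, j) = cover_positions e
      in card {k. j < k \<and> k \<le> n \<and> v i < v k \<and> v k < v j})"


section \<open>Weighted enumeration of saturated chains\<close>

definition saturated_chains ::
    "nat \<Rightarrow> (nat \<Rightarrow> nat) \<Rightarrow> (nat \<Rightarrow> nat) \<Rightarrow> (nat \<Rightarrow> nat) list set" where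
  "saturated_chains n v w =
     {us. us \<noteq> [] \<and> hd us = v \<and> last us = w \<and>
        successively (\<lambda>x y. (x, y) \<in> bruhat_covers n) us}"

definition chain_weight ::
    "((nat \<Rightarrow> nat) \<times> (nat \<Rightarrow> nat) \<Rightarrow> 'r::ring_1) \<Rightarrow> (nat \<Rightarrow> nat) list \<Rightarrow> 'r" where
  "chain_weight wt us = prod_list (map wt (zip us (tl us)))"

definition chain_sum ::
    "nat \<Rightarrow> ((nat \<Rightarrow> nat) \<times> (nat \<Rightarrow> nat) \<Rightarrow> 'r::ring_1) \<Rightarrow> (nat \<Rightarrow> nat) \<Rightarrow> (nat \<Rightarrow> nat) \<Rightarrow> 'r" where
  "chain_sum n wt v w = (\<Sum>us\<in>saturated_chains n v w. chain_weight wt us)"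

text \<open>The sum over chains from an element of \<open>S\<^sub>n\<close> ranges over a finite set.\<close>

lemma bruhat_covers_permutes:
  assumes "(v, w) \<in> bruhat_covers n"
  shows "w permutes {1..n}"
  using assms unfolding bruhat_covers_def
  by (auto intro!: permutes_compose permutes_swap_id)

lemma finite_saturated_chains:
  assumes "v permutes {1..n}"
  shows "finite (saturated_chains n v w)"
proof -
  define R where "R = (\<lambda>x y. (x, y) \<in> bruhat_covers n)"
  have dist: "sorted_wrt (\<lambda>x y. coxeter_length n x < coxeter_length n y) us"
    if "successively R us" for us
  proof -
    have "successively (\<lambda>x y. coxeter_length n x < coxeter_length n y) us"
      using that by (rule successively_mono) (auto simp: R_def bruhat_covers_def)
    then show ?thesis
      by (subst (asm) successively_conv_sorted_wrt) (auto intro!: transpI)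
  qed
  have perm: "set us \<subseteq> {p. p permutes {1..n}}"
    if "successively R us" "us \<noteq> []" "hd us permutes {1..n}" for us
    using that
  proof (induction us rule: induct_list012)
    case (3 x y zs)
    then show ?case using bruhat_covers_permutes[of x y n] by (auto simp: R_def)
  qed auto
  have "saturated_chains n v w \<subseteq> {us. set us \<subseteq> {p. p permutes {1..n}} \<and> distinct us}"
  proof
    fix us assume us: "us \<in> saturated_chains n v w"
    then have s: "successively R us" "us \<noteq> []" "hd us permutes {1..n}"
      using assms by (auto simp: saturated_chains_def R_def)
    have "distinct us"
      using dist[OF s(1)] by (induction us) auto
    with perm[OF s] show "us \<in> {us. set us \<subseteq> {p. p permutes {1..n}} \<and> distinct us}" by simp
  qed
  moreover have "finite {us. set us \<subseteq> {p. p permutes {1..n}} \<and> distinct us}"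
    by (rule finite_subset_distinct) (simp add: finite_permutations)
  ultimately show ?thesis by (rule finite_subset)
qed

text \<open>The polynomial ring \<open>\<int>[z]\<close> is \<^typ>\<open>int poly\<close>, with \<open>z = [:0, 1:]\<close>.\<close>

definition bruhat_wt :: "nat \<Rightarrow> (nat \<Rightarrow> nat) \<times> (nat \<Rightarrow> nat) \<Rightarrow> int poly" where
  "bruhat_wt n e =
     (let z = [:0, 1:] in 1 + of_nat (cover_b e) * (2 - z) + of_nat (cover_c n e) * z)"


section \<open>Schubert polynomials\<close>

text \<open>Polynomials over \<open>\<int>\<close> in variables \<open>x\<^sub>1, x\<^sub>2, \<dots>\<close>, as finitely supported maps from monomials
  (exponent vectors) to coefficients.\<close>

type_synonym mpoly = "(nat \<Rightarrow>\<^sub>0 nat) \<Rightarrow>\<^sub>0 int"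

definition mvar :: "nat \<Rightarrow> mpoly" where
  "mvar i = Poly_Mapping.single (Poly_Mapping.single i 1) 1"

definition mpoly_subst :: "(nat \<Rightarrow> 'r::comm_ring_1) \<Rightarrow> mpoly \<Rightarrow> 'r" where
  "mpoly_subst f p =
     (\<Sum>m\<in>Poly_Mapping.keys p. of_int (Poly_Mapping.lookup p m) *
        (\<Prod>i\<in>Poly_Mapping.keys m. f i ^ Poly_Mapping.lookup m i))"

definition swap_vars :: "nat \<Rightarrow> mpoly \<Rightarrow> mpoly" where
  "swap_vars i = mpoly_subst (\<lambda>k. mvar (simple_refl i k))"

text \<open>The quotient exists, and it is unique since \<^typ>\<open>mpoly\<close> is an integral domain.\<close>

definition divided_diff :: "nat \<Rightarrow> mpoly \<Rightarrow> mpoly" where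
  "divided_diff i g = (THE h. (mvar i - mvar (i + 1)) * h = g - swap_vars i g)"

text \<open>
  The recursion reaches a given \<open>w\<close> along many paths from the longest permutation. As the divided
  differences satisfy the braid relations, all of them yield the same polynomial, so the inductive
  relation below is the graph of a function on \<open>S\<^sub>n\<close>.
\<close>

inductive is_schubert :: "nat \<Rightarrow> (nat \<Rightarrow> nat) \<Rightarrow> mpoly \<Rightarrow> bool" for n where
  longest: "is_schubert n (longest_perm n) (\<Prod>i = 1..n. mvar i ^ (n - i))"
| descend: "is_schubert n (w \<circ> simple_refl i) (divided_diff i P)"
    if "is_schubert n w P" "1 \<le> i" "i < n"
       "coxeter_length n (w \<circ> simple_refl i) < coxeter_length n w"

definition schubert :: "nat \<Rightarrow> (nat \<Rightarrow> nat) \<Rightarrow> mpoly" where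
  "schubert n w = (THE P. is_schubert n w P)"

end

theory Submission
  imports Defs
begin

text \<open>
  Write \<open>\<sigma> w\<close> for \<open>\<SS>\<^sub>w(1, \<dots>, 1)\<close> and \<open>N\<close> for \<open>n choose 2\<close>. Dividing the chain recursion by a factorial,
  the claim becomes \<open>(N - \<ell> w) \<sigma> w = \<Sum> wt(w \<lessdot> u) \<sigma> u\<close>, summed over the covers \<open>u\<close> of \<open>w\<close>. As
  \<open>2 wt = (2 - z)(1 + 2 b) + z (1 + 2 c)\<close>, it is enough to treat the weights \<open>1 + 2 b\<close> and \<open>1 + 2 c\<close>.
  Inversion of permutations exchanges \<open>b\<close> and \<open>c\<close>, so \<open>\<sigma> w = \<sigma> (w\<^sup>-\<^sup>1)\<close> leaves only \<open>1 + 2 b\<close>.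

  The sum of the partial derivatives commutes with the divided differences and hence sends
  \<open>\<SS>\<^sub>w\<close> to the sum of \<open>k \<SS>\<close> at \<open>s\<^sub>k w\<close> over the left descents \<open>k\<close> of \<open>w\<close>. With Euler's identity
  for homogeneous polynomials this gives \<open>\<ell> w \<cdot> \<sigma> w = \<Sum> k \<sigma> (s\<^sub>k w)\<close>; iterating it expresses
  \<open>\<sigma> w\<close> by reduced words, and reversing the words shows the symmetry under inversion.

  Let \<open>D\<close> be the operator \<open>w \<mapsto> \<Sum> k s\<^sub>k w\<close> over left descents and \<open>U\<close> the operator
  \<open>w \<mapsto> \<Sum> (1 + 2 b) u\<close> over strong covers. They satisfy the \<open>sl\<^sub>2\<close> relation
  \<open>D U - U D = N - 2 \<ell>\<close>: off the diagonal both products run over the same pairs with the same weights,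
  and the diagonal is an Abel summation. Applying \<open>\<sigma>\<close>, the statement \<open>\<sigma> (U w) = (N - \<ell> w) \<sigma> w\<close>
  follows by induction on \<open>\<ell> w\<close>.
\<close>

section \<open>Length as number of inversions\<close>

definition inversions :: "nat \<Rightarrow> (nat \<Rightarrow> nat) \<Rightarrow> nat" where
  "inversions n w = card {(a, b). 1 \<le> a \<and> a < b \<and> b \<le> n \<and> w b < w a}"

lemma finite_inversion_pairs: "finite {(a, b). 1 \<le> a \<and> a < b \<and> b \<le> n \<and> P a b}" for n :: nat
  by (rule finite_subset[of _ "{1..n} \<times> {1..n}"]) auto

text \<open>Counting pairs in both orders makes the summand symmetric in the two positions, so that
  the rows and columns of \<open>i\<close> and \<open>j\<close> can be split off a full square when
  two entries are exchanged.\<close>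

lemma inversions_double:
  "2 * int (inversions n w) =
     (\<Sum>a = 1..n. \<Sum>b = 1..n. of_bool ((a < b \<and> w b < w a) \<or> (b < a \<and> w a < w b)))"
proof -
  define A where "A = {(a, b). 1 \<le> a \<and> a < b \<and> b \<le> n \<and> w b < w a}"
  define B where "B = {(a, b). 1 \<le> b \<and> b < a \<and> a \<le> n \<and> w a < w b}"
  have fA: "finite A" unfolding A_def by (rule finite_inversion_pairs)
  have B: "B = prod.swap ` A" by (auto simp: A_def B_def)
  have cB: "card B = card A" unfolding B by (rule card_image) (auto simp: inj_on_def)
  have "(\<Sum>a = 1..n. \<Sum>b = 1..n. of_bool ((a < b \<and> w b < w a) \<or> (b < a \<and> w a < w b))) =
      (\<Sum>p\<in>{1..n} \<times> {1..n}. of_bool (p \<in> A \<union> B) :: int)"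
    unfolding sum.cartesian_product by (rule sum.cong) (auto simp: A_def B_def)
  also have "\<dots> = int (card (A \<union> B))"
    by (subst sum_of_bool_eq) (auto simp: A_def B_def intro!: arg_cong[of _ _ card])
  also have "card (A \<union> B) = card A + card B"
    by (rule card_Un_disjoint) (use fA B in \<open>auto simp: A_def B_def\<close>)
  finally show ?thesis using cB by (simp add: inversions_def A_def)
qed

text \<open>Besides the pair \<open>(i, j)\<close> itself, only pairs joining \<open>i\<close> or
  \<open>j\<close> to a third position \<open>m\<close> are affected. The exchange creates two
  inversions for \<open>m\<close> if it lies between them in position and in value; otherwise the
  total for \<open>m\<close> is unchanged.\<close>

lemma inversions_transpose:
  assumes w: "w permutes {1..n}" and ij: "1 \<le> i" "i < j" "j \<le> n" and lt: "w i < w j"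
  shows "inversions n (w \<circ> transpose i j) =
    inversions n w + 1 + 2 * card {m. i < m \<and> m < j \<and> w i < w m \<and> w m < w j}"
proof -
  define g :: "(nat \<Rightarrow> nat) \<Rightarrow> nat \<Rightarrow> nat \<Rightarrow> int" where
    "g = (\<lambda>u a b. of_bool ((a < b \<and> u b < u a) \<or> (b < a \<and> u a < u b)))"
  define R where "R = {1..n} - {i, j}"
  define u where "u = w \<circ> transpose i j"
  have fR: "finite R" and iR: "i \<notin> R" "j \<notin> R" "i \<noteq> j" using ij by (auto simp: R_def)
  have I: "{1..n} = insert i (insert j R)" using ij by (auto simp: R_def)
  have ui: "u i = w j" "u j = w i" and uR: "\<And>m. m \<in> R \<Longrightarrow> u m = w m"
    using ij by (auto simp: u_def R_def)
  have gs: "g v a b = g v b a" for v a b unfolding g_def by (intro arg_cong[of _ _ of_bool]) blast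
  have E: "2 * int (inversions n v) = 2 * g v i j + 2 * (\<Sum>m\<in>R. g v i m + g v j m)
       + (\<Sum>a\<in>R. \<Sum>b\<in>R. g v a b)" for v
  proof -
    have "2 * int (inversions n v) = (\<Sum>a\<in>insert i (insert j R). \<Sum>b\<in>insert i (insert j R). g v a b)"
      unfolding inversions_double g_def I[symmetric] ..
    also have "\<dots> = 2 * g v i j + 2 * (\<Sum>m\<in>R. g v i m + g v j m) + (\<Sum>a\<in>R. \<Sum>b\<in>R. g v a b)"
    proof -
      have d: "g v i i = 0" "g v j j = 0" by (simp_all add: g_def)
      have s: "(\<Sum>a\<in>R. g v a i) = (\<Sum>a\<in>R. g v i a)" "(\<Sum>a\<in>R. g v a j) = (\<Sum>a\<in>R. g v j a)"
        by (rule sum.cong[OF refl gs])+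
      show ?thesis
        using iR gs[of v j i] by (simp add: sum.insert[OF fR] fR d s sum.distrib)
    qed
    finally show ?thesis .
  qed
  have ne: "w m \<noteq> w i" "w m \<noteq> w j" if "m \<in> R" for m
    using that permutes_inj[OF w] by (auto simp: R_def inj_eq)
  have "g u i m + g u j m = g w i m + g w j m +
      2 * of_bool (i < m \<and> m < j \<and> w i < w m \<and> w m < w j)" if m: "m \<in> R" for m
  proof -
    have "m \<noteq> i" "m \<noteq> j" using m by (auto simp: R_def)
    then consider "m < i" | "i < m" "m < j" | "j < m" by linarith
    then show ?thesis
      using ne[OF m] ij lt by cases (auto simp: g_def ui uR[OF m] of_bool_def)
  qed
  then have "(\<Sum>m\<in>R. g u i m + g u j m) = (\<Sum>m\<in>R. g w i m + g w j m) +
      2 * (\<Sum>m\<in>R. of_bool (i < m \<and> m < j \<and> w i < w m \<and> w m < w j))"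
    by (simp add: sum.distrib sum_distrib_left)
  also have "(\<Sum>m\<in>R. of_bool (i < m \<and> m < j \<and> w i < w m \<and> w m < w j)) =
      int (card {m. i < m \<and> m < j \<and> w i < w m \<and> w m < w j})"
    using fR ij by (subst sum_of_bool_eq) (auto simp: R_def intro!: arg_cong[of _ _ card])
  finally have S: "(\<Sum>m\<in>R. g u i m + g u j m) = (\<Sum>m\<in>R. g w i m + g w j m) +
      2 * int (card {m. i < m \<and> m < j \<and> w i < w m \<and> w m < w j})" .
  have "(\<Sum>a\<in>R. \<Sum>b\<in>R. g u a b) = (\<Sum>a\<in>R. \<Sum>b\<in>R. g w a b)"
    by (intro sum.cong refl) (simp add: g_def uR)
  moreover have "g u i j = 1" "g w i j = 0" using ij lt by (auto simp: g_def ui)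
  ultimately have "2 * int (inversions n u) = 2 * int (inversions n w) + 2 +
      4 * int (card {m. i < m \<and> m < j \<and> w i < w m \<and> w m < w j})"
    using E[of u] E[of w] S by simp
  then show ?thesis unfolding u_def by linarith
qed

lemma permutes_comp_transpose:
  assumes "w permutes {1..n}" "1 \<le> i" "i \<le> n" "1 \<le> j" "j \<le> n"
  shows "w \<circ> transpose i j permutes {1..n}" "transpose i j \<circ> w permutes {1..n}"
  using assms by (auto intro!: permutes_compose permutes_swap_id)

lemma inversions_simple_right:
  assumes w: "w permutes {1..n}" and i: "1 \<le> i" "i < n"
  shows "w i < w (i + 1) \<Longrightarrow> inversions n (w \<circ> simple_refl i) = inversions n w + 1"
    and "w (i + 1) < w i \<Longrightarrow> inversions n w = inversions n (w \<circ> simple_refl i) + 1"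
proof -
  have *: "inversions n (v \<circ> simple_refl i) = inversions n v + 1"
    if "v permutes {1..n}" "v i < v (i + 1)" for v
  proof -
    have e: "{m. i < m \<and> m < i + 1 \<and> v i < v m \<and> v m < v (i + 1)} = {}" by auto
    show ?thesis using inversions_transpose[of v n i "i + 1"] that i unfolding e by simp
  qed
  then show "w i < w (i + 1) \<Longrightarrow> inversions n (w \<circ> simple_refl i) = inversions n w + 1"
    using w by simp
  show "inversions n w = inversions n (w \<circ> simple_refl i) + 1" if "w (i + 1) < w i"
    using *[of "w \<circ> simple_refl i"] permutes_comp_transpose(1)[OF w, of i "i + 1"] i that
    by (simp add: comp_assoc)
qed

text \<open>An inversion of \<open>w\<close> at \<open>(a, b)\<close> becomes an inversion of the
  inverse at \<open>(w b, w a)\<close>.\<close>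

lemma inversions_inv:
  assumes w: "w permutes {1..n}"
  shows "inversions n (inv w) = inversions n w"
proof -
  have I: "inv w (w a) = a" "w (inv w a) = a" for a using permutes_inverses[OF w] by auto
  have m: "w a \<in> {1..n} \<longleftrightarrow> a \<in> {1..n}" "inv w a \<in> {1..n} \<longleftrightarrow> a \<in> {1..n}" for a
    using permutes_in_image[OF w] permutes_in_image[OF permutes_inv[OF w]] by auto
  have "bij_betw (\<lambda>(a, b). (w b, w a)) {(a, b). 1 \<le> a \<and> a < b \<and> b \<le> n \<and> w b < w a}
     {(a, b). 1 \<le> a \<and> a < b \<and> b \<le> n \<and> inv w b < inv w a}"
    by (rule bij_betw_byWitness[where f' = "\<lambda>(a, b). (inv w b, inv w a)"])
       (use m in \<open>fastforce simp: I\<close>)+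
  from bij_betw_same_card[OF this] show ?thesis by (simp add: inversions_def)
qed

lemma inversions_simple_left:
  assumes w: "w permutes {1..n}" and k: "1 \<le> k" "k < n"
  shows "inv w k < inv w (k + 1) \<Longrightarrow> inversions n (simple_refl k \<circ> w) = inversions n w + 1"
    and "inv w (k + 1) < inv w k \<Longrightarrow> inversions n w = inversions n (simple_refl k \<circ> w) + 1"
proof -
  have "inv (simple_refl k \<circ> w) = inv w \<circ> simple_refl k"
    by (simp add: o_inv_distrib permutes_bij[OF w])
  then have e: "inversions n (simple_refl k \<circ> w) = inversions n (inv w \<circ> simple_refl k)"
    using inversions_inv[OF permutes_comp_transpose(2)[OF w, of k "k + 1"]] k by simp
  show "inv w k < inv w (k + 1) \<Longrightarrow> inversions n (simple_refl k \<circ> w) = inversions n w + 1"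
    and "inv w (k + 1) < inv w k \<Longrightarrow> inversions n w = inversions n (simple_refl k \<circ> w) + 1"
    using inversions_simple_right[OF permutes_inv[OF w] k] unfolding e inversions_inv[OF w] by simp_all
qed

text \<open>Monotonicity gives \<open>i \<le> w i\<close> by induction upwards from
  \<open>1\<close>, and \<open>w i \<le> i\<close> by induction downwards from
  \<open>n\<close>.\<close>

lemma permutes_increasing_eq_id:
  fixes n :: nat
  assumes w: "w permutes {1..n}" and inc: "\<And>i. 1 \<le> i \<Longrightarrow> i < n \<Longrightarrow> w i < w (i + 1)"
  shows "w = id"
proof -
  have up: "i \<le> w i" if "1 \<le> i" "i \<le> n" for i :: nat
    using that(1,2)
  proof (induction i rule: dec_induct)
    case base
    then show ?case using permutes_in_image[OF w, of 1] by auto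
  next
    case (step i)
    then show ?case using inc[of i] by auto
  qed
  have dn: "w i \<le> i" if "1 \<le> i" "i \<le> n" for i :: nat
    using that(2,1)
  proof (induction i rule: inc_induct)
    case base
    then show ?case using permutes_in_image[OF w, of n] by auto
  next
    case (step i)
    then show ?case using inc[of i] by auto
  qed
  show ?thesis
  proof
    fix i show "w i = id i"
      using up[of i] dn[of i] permutes_not_in[OF w, of i] by (cases "i \<in> {1..n}") auto
  qed
qed

lemma longest_perm_permutes: "longest_perm n permutes {1..n}"
proof (rule bij_imp_permutes)
  show "bij_betw (longest_perm n) {1..n} {1..n}"
    by (rule bij_betw_byWitness[where f' = "longest_perm n"]) (auto simp: longest_perm_def)
qed (auto simp: longest_perm_def)

lemma longest_perm_comp_self: "longest_perm n \<circ> longest_perm n = id"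
  by (auto simp: longest_perm_def fun_eq_iff)

text \<open>Multiplying by \<open>longest_perm n\<close> on the left reverses the values and reduces
  the claim to the increasing case.\<close>

lemma permutes_decreasing_eq_longest:
  assumes w: "w permutes {1..n}" and dec: "\<And>i. 1 \<le> i \<Longrightarrow> i < n \<Longrightarrow> w (i + 1) < w i"
  shows "w = longest_perm n"
proof -
  have r: "w i \<in> {1..n}" if "i \<in> {1..n}" for i using permutes_in_image[OF w] that by blast
  have "longest_perm n \<circ> w = id"
  proof (rule permutes_increasing_eq_id)
    show "longest_perm n \<circ> w permutes {1..n}"
      by (rule permutes_compose[OF w longest_perm_permutes])
    show "(longest_perm n \<circ> w) i < (longest_perm n \<circ> w) (i + 1)" if "1 \<le> i" "i < n" for i
      using dec[OF that] r[of i] r[of "i + 1"] that by (simp add: longest_perm_def)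
  qed
  then have "longest_perm n \<circ> (longest_perm n \<circ> w) = longest_perm n" by simp
  then show ?thesis by (simp add: comp_assoc[symmetric] longest_perm_comp_self)
qed

lemma permutes_lt_or_gt:
  fixes n a b :: nat
  assumes "w permutes {1..n}" "a \<noteq> b"
  shows "w a < w b \<or> w b < w a"
  using permutes_inj[OF assms(1)] assms(2) by (metis inj_eq linorder_neqE_nat)

section \<open>Reduced words and Coxeter length\<close>

lemma word_prod_simps [simp]: "word_prod [] = id" "word_prod (i # is) = simple_refl i \<circ> word_prod is"
  by (simp_all add: word_prod_def)

lemma word_prod_permutes: "set is \<subseteq> {1..<n} \<Longrightarrow> word_prod is permutes {1..n}"
proof (induction "is")
  case (Cons i js)
  then show ?case using permutes_comp_transpose(2)[of "word_prod js" n i "i + 1"] by (simp add: comp_def)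
qed (simp add: permutes_id)

lemma inversions_id [simp]: "inversions n id = 0" "inversions n (\<lambda>x. x) = 0"
  by (auto simp: inversions_def card_eq_0_iff)

text \<open>Every letter changes the number of inversions by exactly one.\<close>

lemma inversions_word_prod_le: "set is \<subseteq> {1..<n} \<Longrightarrow> inversions n (word_prod is) \<le> length is"
proof (induction "is")
  case (Cons i js)
  then have p: "word_prod js permutes {1..n}" and i: "1 \<le> i" "i < n"
    using word_prod_permutes by auto
  show ?case
    using permutes_lt_or_gt[OF permutes_inv[OF p], of i "i + 1"] inversions_simple_left[OF p i] Cons
    by (auto simp: comp_def)
qed simp

lemma exists_left_descent:
  fixes n :: nat
  assumes w: "w permutes {1..n}" and "w \<noteq> id"
  obtains k where "1 \<le> k" "k < n" "inv w (k + 1) < inv w k"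
proof -
  have "inv w \<noteq> id" using assms by (metis inv_id inv_inv_eq permutes_bij)
  then obtain k where "1 \<le> k" "k < n" "\<not> inv w k < inv w (k + 1)"
    using permutes_increasing_eq_id[OF permutes_inv[OF w]] by blast
  then show ?thesis using that permutes_lt_or_gt[OF permutes_inv[OF w], of k "k + 1"] by auto
qed

text \<open>Removing a left descent lowers the number of inversions by one; the letters removed
  until the identity is reached spell the word.\<close>

lemma exists_reduced_word:
  assumes "w permutes {1..n}"
  shows "\<exists>is. set is \<subseteq> {1..<n} \<and> length is = inversions n w \<and> word_prod is = w"
  using assms
proof (induction "inversions n w" arbitrary: w)
  case 0
  have "w = id"
  proof (rule ccontr)
    assume "w \<noteq> id"
    then obtain k where "1 \<le> k" "k < n" "inv w (k + 1) < inv w k"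
      using exists_left_descent 0 by blast
    then show False using inversions_simple_left(2)[OF 0(2)] 0(1) by simp
  qed
  then show ?case by (auto intro!: exI[of _ "[]"])
next
  case (Suc l)
  then have "w \<noteq> id" by auto
  then obtain k where k: "1 \<le> k" "k < n" "inv w (k + 1) < inv w k"
    using exists_left_descent Suc.prems by blast
  let ?u = "simple_refl k \<circ> w"
  have "?u permutes {1..n}" using permutes_comp_transpose(2)[OF Suc.prems] k by simp
  moreover have "inversions n w = inversions n ?u + 1" using inversions_simple_left(2) Suc.prems k by simp
  ultimately obtain js where "set js \<subseteq> {1..<n}" "length js = inversions n ?u" "word_prod js = ?u"
    using Suc.hyps(1)[of ?u] Suc.hyps(2) by auto
  then show ?case using k \<open>inversions n w = _\<close>
    by (intro exI[of _ "k # js"]) (auto simp: comp_assoc[symmetric])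
qed

lemma coxeter_length_eq_inversions:
  assumes "w permutes {1..n}"
  shows "coxeter_length n w = inversions n w"
  unfolding coxeter_length_def
  by (rule Least_equality) (use exists_reduced_word[OF assms] inversions_word_prod_le in auto)

lemma card_pairs_less: "card {(a, b). 1 \<le> a \<and> a < b \<and> b \<le> n} = n choose 2" for n :: nat
proof -
  have "{(a, b). 1 \<le> a \<and> a < b \<and> b \<le> n} = prod.swap ` (SIGMA b:{1..n}. {1..<b})" by force
  then have "card {(a, b). 1 \<le> a \<and> a < b \<and> b \<le> n} = (\<Sum>b = 1..n. b - 1)"
    by (simp add: card_image)
  also have "\<dots> = n choose 2"
    by (induction n) (auto simp: numeral_2_eq_2)
  finally show ?thesis .
qed

lemma inversions_le: "inversions n w \<le> n choose 2"
  unfolding inversions_def card_pairs_less[symmetric]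
  by (rule card_mono) (use finite_inversion_pairs[of n "\<lambda>_ _. True"] in auto)

lemma inversions_longest: "inversions n (longest_perm n) = n choose 2"
  unfolding inversions_def card_pairs_less[symmetric]
  by (rule arg_cong[of _ _ card]) (auto simp: longest_perm_def)

text \<open>A right ascent could still be turned into one more inversion, so a permutation attaining
  the maximum has only descents.\<close>

lemma inversions_eq_choose_iff:
  assumes w: "w permutes {1..n}"
  shows "inversions n w = n choose 2 \<longleftrightarrow> w = longest_perm n"
proof
  assume e: "inversions n w = n choose 2"
  show "w = longest_perm n"
  proof (rule permutes_decreasing_eq_longest[OF w])
    fix i assume i: "1 \<le> i" "i < n"
    show "w (i + 1) < w i"
      using permutes_lt_or_gt[OF w, of i "i + 1"] inversions_simple_right(1)[OF w i] e
        inversions_le[of n "w \<circ> simple_refl i"] by auto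
  qed
qed (simp add: inversions_longest)

section \<open>Divided differences\<close>

definition monom_subst :: "(nat \<Rightarrow> 'r::comm_ring_1) \<Rightarrow> (nat \<Rightarrow>\<^sub>0 nat) \<Rightarrow> 'r" where
  "monom_subst f m = (\<Prod>i\<in>Poly_Mapping.keys m. f i ^ Poly_Mapping.lookup m i)"

lemma monom_subst_superset:
  assumes "finite B" "Poly_Mapping.keys m \<subseteq> B"
  shows "monom_subst f m = (\<Prod>i\<in>B. f i ^ Poly_Mapping.lookup m i)"
  unfolding monom_subst_def
  by (rule prod.mono_neutral_left[OF assms]) (auto simp: in_keys_iff)

lemma monom_subst_add: "monom_subst f (m + m') = monom_subst f m * monom_subst f m'"
proof -
  let ?B = "Poly_Mapping.keys m \<union> Poly_Mapping.keys m'"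
  have "monom_subst f (m + m') = (\<Prod>i\<in>?B. f i ^ Poly_Mapping.lookup (m + m') i)"
    by (rule monom_subst_superset) (auto dest: set_mp[OF keys_add])
  also have "\<dots> = monom_subst f m * monom_subst f m'"
    by (simp add: monom_subst_superset[of ?B] lookup_add power_add prod.distrib)
  finally show ?thesis .
qed

lemma mpoly_subst_superset:
  assumes "finite A" "Poly_Mapping.keys p \<subseteq> A"
  shows "mpoly_subst f p = (\<Sum>m\<in>A. of_int (Poly_Mapping.lookup p m) * monom_subst f m)"
  unfolding mpoly_subst_def monom_subst_def
  by (rule sum.mono_neutral_left[OF assms]) (auto simp: in_keys_iff)

lemma mpoly_subst_add: "mpoly_subst f (p + q) = mpoly_subst f p + mpoly_subst f q"
proof -
  let ?A = "Poly_Mapping.keys p \<union> Poly_Mapping.keys q"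
  have "mpoly_subst f (p + q) = (\<Sum>m\<in>?A. of_int (Poly_Mapping.lookup (p + q) m) * monom_subst f m)"
    by (rule mpoly_subst_superset) (auto dest: set_mp[OF keys_add])
  also have "\<dots> = mpoly_subst f p + mpoly_subst f q"
    by (simp add: mpoly_subst_superset[of ?A] lookup_add sum.distrib distrib_right)
  finally show ?thesis .
qed

lemma mpoly_subst_zero [simp]: "mpoly_subst f 0 = 0"
  by (simp add: mpoly_subst_def)

lemma mpoly_subst_sum: "mpoly_subst f (\<Sum>x\<in>A. g x) = (\<Sum>x\<in>A. mpoly_subst f (g x))"
  by (induction A rule: infinite_finite_induct) (auto simp: mpoly_subst_add)

lemma mpoly_subst_single: "mpoly_subst f (Poly_Mapping.single m c) = of_int c * monom_subst f m"
  by (simp add: mpoly_subst_superset[of "{m}"])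

lemma mpoly_eq_sum_single: "p = (\<Sum>m\<in>Poly_Mapping.keys p. Poly_Mapping.single m (Poly_Mapping.lookup p m))"
  by (rule poly_mapping_eqI) (auto simp: lookup_sum lookup_single when_def in_keys_iff)

lemma mpoly_subst_mult: "mpoly_subst f (p * q) = mpoly_subst f p * mpoly_subst f q"
proof -
  let ?s = "\<lambda>p m. Poly_Mapping.single m (Poly_Mapping.lookup p m)"
  have "p * q = (\<Sum>m\<in>Poly_Mapping.keys p. \<Sum>m'\<in>Poly_Mapping.keys q. ?s p m * ?s q m')"
    by (simp only: sum_product[symmetric] mpoly_eq_sum_single[symmetric])
  then have "mpoly_subst f (p * q) = (\<Sum>m\<in>Poly_Mapping.keys p. \<Sum>m'\<in>Poly_Mapping.keys q.
      mpoly_subst f (?s p m) * mpoly_subst f (?s q m'))"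
    by (simp add: mpoly_subst_sum mult_single mpoly_subst_single monom_subst_add mult_ac)
  also have "\<dots> = mpoly_subst f (\<Sum>m\<in>Poly_Mapping.keys p. ?s p m) * mpoly_subst f (\<Sum>m\<in>Poly_Mapping.keys q. ?s q m)"
    by (simp add: mpoly_subst_sum sum_product)
  finally show ?thesis by (simp only: mpoly_eq_sum_single[symmetric])
qed

lemma mpoly_subst_one [simp]: "mpoly_subst f 1 = 1"
  using mpoly_subst_single[of f 0 1] by (simp add: monom_subst_def)

lemma mpoly_subst_mvar [simp]: "mpoly_subst f (mvar i) = f i"
  by (simp add: mvar_def mpoly_subst_single monom_subst_def)

lemma mpoly_subst_diff: "mpoly_subst f (p - q) = mpoly_subst f p - mpoly_subst f q"
  using mpoly_subst_add[of f "p - q" q] by (simp add: algebra_simps)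

lemma mpoly_subst_prod: "mpoly_subst f (\<Prod>x\<in>A. g x) = (\<Prod>x\<in>A. mpoly_subst f (g x))"
  by (induction A rule: infinite_finite_induct) (auto simp: mpoly_subst_mult)

lemma mpoly_subst_power: "mpoly_subst f (p ^ k) = mpoly_subst f p ^ k"
  by (induction k) (auto simp: mpoly_subst_mult)

lemma mpoly_subst_of_nat: "mpoly_subst f (of_nat k) = of_nat k"
  by (induction k) (auto simp: mpoly_subst_add)

text \<open>Integer polynomials form a free commutative ring, so a ring homomorphism acts only on
  the substituted values. It is given by its equations so that evaluations, the constant coefficient
  and coefficientwise maps can all be inserted.\<close>

lemma hom_mpoly_subst:
  fixes F :: "'a::comm_ring_1 \<Rightarrow> 'b::comm_ring_1"
  assumes add: "\<And>x y. F (x + y) = F x + F y" and mult: "\<And>x y. F (x * y) = F x * F y"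
    and one: "F 1 = 1"
  shows "F (mpoly_subst f p) = mpoly_subst (\<lambda>k. F (f k)) p"
proof -
  have zero: "F 0 = 0" using add[of 0 0] by simp
  have minus: "F (- x) = - F x" for x using add[of x "- x"] by (simp add: zero add_eq_0_iff)
  have nat: "F (of_nat k) = of_nat k" for k by (induction k) (simp_all add: zero add one)
  have int: "F (of_int c) = of_int c" for c by (cases c rule: int_cases2) (simp_all add: nat minus)
  have pow: "F (x ^ k) = F x ^ k" for x k by (induction k) (simp_all add: one mult)
  have sum: "F (sum g A) = (\<Sum>x\<in>A. F (g x))" for g and A :: "(nat \<Rightarrow>\<^sub>0 nat) set"
    by (induction A rule: infinite_finite_induct) (simp_all add: zero add)
  have prod: "F (prod g A) = (\<Prod>x\<in>A. F (g x))" for g and A :: "nat set"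
    by (induction A rule: infinite_finite_induct) (simp_all add: one mult)
  show ?thesis by (simp add: mpoly_subst_def sum prod pow int mult)
qed

lemma mpoly_subst_mpoly_subst: "mpoly_subst f (mpoly_subst g p) = mpoly_subst (\<lambda>k. mpoly_subst f (g k)) p"
  by (rule hom_mpoly_subst) (simp_all add: mpoly_subst_add mpoly_subst_mult)

lemma mpoly_subst_mvar_id: "mpoly_subst mvar p = p"
proof -
  have pow: "mvar i ^ k = Poly_Mapping.single (Poly_Mapping.single i k) 1" for i k
    by (induction k) (simp_all add: mvar_def mult_single single_add[symmetric])
  have prod: "(\<Prod>i\<in>A. Poly_Mapping.single (g i) (1 :: int)) = Poly_Mapping.single (sum g A) 1"
    for g :: "nat \<Rightarrow> nat \<Rightarrow>\<^sub>0 nat" and A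
    by (induction A rule: infinite_finite_induct) (simp_all add: mult_single)
  have "monom_subst mvar m = Poly_Mapping.single (\<Sum>i\<in>Poly_Mapping.keys m. Poly_Mapping.single i (Poly_Mapping.lookup m i)) 1" for m
    by (simp add: monom_subst_def pow prod)
  also have "(\<Sum>i\<in>Poly_Mapping.keys m. Poly_Mapping.single i (Poly_Mapping.lookup m i)) = m" for m :: "nat \<Rightarrow>\<^sub>0 nat"
    by (rule poly_mapping_eqI) (auto simp: lookup_sum lookup_single when_def in_keys_iff)
  finally have m: "monom_subst mvar m = Poly_Mapping.single m 1" for m .
  have c: "(of_int c :: mpoly) = Poly_Mapping.single 0 c" for c
    by (metis of_int_eq_id id_apply single_of_int)
  have "mpoly_subst mvar p = (\<Sum>m\<in>Poly_Mapping.keys p. Poly_Mapping.single m (Poly_Mapping.lookup p m))"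
    unfolding mpoly_subst_superset[OF finite_keys subset_refl] m c mult_single by simp
  then show ?thesis by (simp only: mpoly_eq_sum_single[symmetric])
qed

lemma dvd_diff_mult:
  fixes d :: "'a::comm_ring_1"
  assumes "d dvd a - b" "d dvd a' - b'"
  shows "d dvd a * a' - b * b'"
proof -
  have "a * a' - b * b' = (a - b) * a' + b * (a' - b')" by (simp add: algebra_simps)
  then show ?thesis using assms by simp
qed

text \<open>Congruence modulo \<open>d\<close> is preserved by sums and products, hence by
  evaluation of a polynomial.\<close>

lemma dvd_mpoly_subst_diff:
  assumes "\<And>k. d dvd f k - g k"
  shows "d dvd mpoly_subst f p - mpoly_subst g p"
proof -
  have pow: "d dvd f k ^ j - g k ^ j" for k j
    by (induction j) (auto intro: dvd_diff_mult assms)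
  have prod: "d dvd (\<Prod>k\<in>A. f k ^ e k) - (\<Prod>k\<in>A. g k ^ e k)" for A and e :: "nat \<Rightarrow> nat"
    by (induction A rule: infinite_finite_induct) (auto intro: dvd_diff_mult pow)
  show ?thesis unfolding mpoly_subst_def sum_subtractf[symmetric]
    by (intro dvd_sum dvd_diff_mult prod) simp
qed

section \<open>Exchange of variables and divided differences\<close>

lemma swap_vars_simps [simp]:
  "swap_vars i 0 = 0" "swap_vars i 1 = 1" "swap_vars i (of_nat k) = of_nat k"
  "swap_vars i (p + q) = swap_vars i p + swap_vars i q"
  "swap_vars i (p - q) = swap_vars i p - swap_vars i q"
  "swap_vars i (p * q) = swap_vars i p * swap_vars i q"
  "swap_vars i (sum f A) = (\<Sum>x\<in>A. swap_vars i (f x))"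
  "swap_vars i (prod f A) = (\<Prod>x\<in>A. swap_vars i (f x))"
  "swap_vars i (p ^ k) = swap_vars i p ^ k"
  "swap_vars i (mvar k) = mvar (simple_refl i k)"
  by (simp_all add: swap_vars_def mpoly_subst_add mpoly_subst_diff mpoly_subst_mult mpoly_subst_sum
      mpoly_subst_prod mpoly_subst_power mpoly_subst_of_nat)

lemma swap_vars_comp:
  "swap_vars i (swap_vars j p) = mpoly_subst (\<lambda>k. mvar (simple_refl i (simple_refl j k))) p"
  by (simp add: swap_vars_def mpoly_subst_mpoly_subst)

lemma swap_vars_swap_vars [simp]: "swap_vars i (swap_vars i p) = p"
  by (simp add: swap_vars_comp mpoly_subst_mvar_id)

lemma swap_vars_commute:
  assumes "i + 1 < j"
  shows "swap_vars i (swap_vars j p) = swap_vars j (swap_vars i p)"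
proof -
  have "simple_refl i (simple_refl j k) = simple_refl j (simple_refl i k)" for k
    using assms by (auto simp: transpose_def)
  then show ?thesis by (simp add: swap_vars_comp)
qed

lemma swap_vars_braid:
  "swap_vars i (swap_vars (i + 1) (swap_vars i p)) = swap_vars (i + 1) (swap_vars i (swap_vars (i + 1) p))"
proof -
  have "simple_refl i (simple_refl (i + 1) (simple_refl i k)) =
      simple_refl (i + 1) (simple_refl i (simple_refl (i + 1) k))" for k
    by (auto simp: transpose_def)
  then show ?thesis by (simp add: swap_vars_def mpoly_subst_mpoly_subst)
qed

lemma mvar_eq_iff [simp]: "mvar i = mvar j \<longleftrightarrow> i = j"
proof
  assume "mvar i = mvar j"
  then have "mpoly_subst (\<lambda>k. int k) (mvar i) = mpoly_subst (\<lambda>k. int k) (mvar j)" by simp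
  then show "i = j" by simp
qed simp

lemma mvar_diff_nonzero: "mvar i - mvar (i + 1) \<noteq> 0"
  by simp

text \<open>Cancellation in an integral domain. From here on a divided difference is identified by
  checking the equation multiplied by its denominator.\<close>

lemma divided_diff_unique:
  assumes "(mvar i - mvar (i + 1)) * h = g - swap_vars i g"
  shows "divided_diff i g = h"
  unfolding divided_diff_def
proof (rule the_equality[where P = "\<lambda>h. (mvar i - mvar (i + 1)) * h = g - swap_vars i g", OF assms])
  fix h' assume "(mvar i - mvar (i + 1)) * h' = g - swap_vars i g"
  then show "h' = h" using assms mvar_diff_nonzero[of i] by (metis mult_left_cancel)
qed

text \<open>Modulo \<open>mvar i - mvar (i + 1)\<close> the exchange fixes every variable, hence
  every polynomial, so the numerator is divisible.\<close>

lemma divided_diff: "(mvar i - mvar (i + 1)) * divided_diff i g = g - swap_vars i g"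
proof -
  have "mvar i - mvar (i + 1) dvd mvar k - mvar (simple_refl i k)" for k
  proof -
    consider "k = i" | "k = i + 1" | "simple_refl i k = k"
      by (metis transpose_apply_other)
    then show ?thesis
    proof cases
      case 2
      have "mvar (i + 1) - mvar i = (mvar i - mvar (i + 1)) * (- 1)" by simp
      then show ?thesis using 2 by (metis dvd_triv_left transpose_apply_second)
    qed auto
  qed
  then have "mvar i - mvar (i + 1) dvd mpoly_subst mvar g - swap_vars i g"
    unfolding swap_vars_def by (rule dvd_mpoly_subst_diff)
  then obtain h where "g - swap_vars i g = (mvar i - mvar (i + 1)) * h"
    by (auto simp: mpoly_subst_mvar_id)
  then show ?thesis using divided_diff_unique[of i h g] by simp
qed

lemma swap_vars_divided_diff: "swap_vars i (divided_diff i g) = divided_diff i g"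
proof -
  have "swap_vars i ((mvar i - mvar (i + 1)) * divided_diff i g) = swap_vars i (g - swap_vars i g)"
    by (simp only: divided_diff)
  then have "(mvar i - mvar (i + 1)) * swap_vars i (divided_diff i g) = g - swap_vars i g"
    by (simp add: algebra_simps)
  from divided_diff_unique[OF this] show ?thesis by simp
qed

lemma divided_diff_divided_diff [simp]: "divided_diff i (divided_diff i g) = 0"
  by (rule divided_diff_unique) (simp add: swap_vars_divided_diff)

lemma divided_diff_sum:
  "divided_diff i (\<Sum>k\<in>A. of_nat k * f k) = (\<Sum>k\<in>A. of_nat k * divided_diff i (f k))"
proof (rule divided_diff_unique)
  have "(mvar i - mvar (i + 1)) * (\<Sum>k\<in>A. of_nat k * divided_diff i (f k)) =
      (\<Sum>k\<in>A. of_nat k * ((mvar i - mvar (i + 1)) * divided_diff i (f k)))"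
    by (simp add: sum_distrib_left mult_ac)
  also have "\<dots> = (\<Sum>k\<in>A. of_nat k * f k) - swap_vars i (\<Sum>k\<in>A. of_nat k * f k)"
    unfolding divided_diff by (simp add: sum_subtractf right_diff_distrib)
  finally show "(mvar i - mvar (i + 1)) * (\<Sum>k\<in>A. of_nat k * divided_diff i (f k)) =
     (\<Sum>k\<in>A. of_nat k * f k) - swap_vars i (\<Sum>k\<in>A. of_nat k * f k)" .
qed

text \<open>Neither exchange affects the denominator of the other. Multiplied by both denominators,
  the two sides become the same alternating sum over two commuting exchanges.\<close>

lemma divided_diff_commute:
  assumes "i + 1 < j"
  shows "divided_diff i (divided_diff j g) = divided_diff j (divided_diff i g)"
proof -
  define A where "A = mvar i - mvar (i + 1)"
  define B where "B = mvar j - mvar (j + 1)"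
  have AB: "swap_vars i B = B" "swap_vars j A = A" using assms by (simp_all add: A_def B_def)
  have 1: "A * divided_diff i p = p - swap_vars i p" "B * divided_diff j p = p - swap_vars j p" for p
    using divided_diff by (simp_all add: A_def B_def)
  have "A * B * divided_diff i (divided_diff j g) = B * divided_diff j g - swap_vars i (B * divided_diff j g)"
    unfolding swap_vars_simps AB mult.commute[of A B] mult.assoc 1(1) by (simp add: right_diff_distrib)
  moreover have "A * B * divided_diff j (divided_diff i g) = A * divided_diff i g - swap_vars j (A * divided_diff i g)"
    unfolding swap_vars_simps AB mult.assoc 1(2) by (simp add: right_diff_distrib)
  ultimately have "A * B * divided_diff i (divided_diff j g) = A * B * divided_diff j (divided_diff i g)"
    unfolding 1 by (simp add: swap_vars_commute[OF assms])
  moreover have "A * B \<noteq> 0" by (simp add: A_def B_def)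
  ultimately show ?thesis by (metis mult_left_cancel)
qed

text \<open>With \<open>C = A + B\<close>, the product \<open>A B C\<close> is the Vandermonde determinant of the three variables
  involved, and the right-hand side is the alternating sum over their permutations.\<close>

lemma divided_diff_three:
  assumes A: "A = mvar i - mvar (i + 1)" and B: "B = mvar j - mvar (j + 1)"
    and sB: "swap_vars i B = A + B" and tA: "swap_vars j A = A + B"
  defines "s \<equiv> swap_vars i" and "t \<equiv> swap_vars j"
  shows "A * B * (A + B) * divided_diff i (divided_diff j (divided_diff i g)) =
    g - s g - t g + s (t g) + t (s g) - s (t (s g))"
proof -
  define h1 h2 h3 where "h1 = divided_diff i g" and "h2 = divided_diff j h1" and "h3 = divided_diff i h2"
  have hom: "s (p - q) = s p - s q" "s (p * q) = s p * s q" "s (p + q) = s p + s q"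
      "t (p - q) = t p - t q" "t (p * q) = t p * t q" "t (p + q) = t p + t q" for p q
    by (simp_all add: s_def t_def)
  have AB: "s A = - A" "s B = A + B" "t A = A + B" "s (A + B) = B"
    using sB tA by (simp_all add: s_def t_def A)
  have ss: "s (s p) = p" for p by (simp add: s_def)
  have 1: "A * h1 = g - s g" "B * h2 = h1 - t h1" "A * h3 = h2 - s h2"
    using divided_diff by (simp_all add: A B h1_def h2_def h3_def s_def t_def)
  \<comment> \<open>The exchange \<open>t\<close> maps the denominator \<open>A\<close> of
    \<open>h1\<close> to \<open>A + B\<close>, which supplies the third Vandermonde factor.\<close>
  have th1: "(A + B) * t h1 = t g - t (s g)"
    using arg_cong[OF 1(1), of t] by (simp add: hom AB)
  have "A * B * (A + B) * h2 = (A + B) * (A * h1) - A * ((A + B) * t h1)"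
    using arg_cong[OF 1(2), of "\<lambda>x. A * (A + B) * x"] by (simp add: algebra_simps)
  then have 2: "A * B * (A + B) * h2 = (A + B) * (g - s g) - A * (t g - t (s g))"
    unfolding 1 th1 .
  \<comment> \<open>The product \<open>A * B * (A + B)\<close> is alternating, so its image under
    \<open>s\<close> carries a minus sign.\<close>
  have 3: "- (A * B * (A + B) * s h2) = B * (s g - g) + A * (s (t g) - s (t (s g)))"
    using arg_cong[OF 2, of s] by (simp add: hom AB ss) (simp add: algebra_simps)
  have "A * B * (A + B) * (h2 - s h2) = A * B * (A + B) * h2 + - (A * B * (A + B) * s h2)"
    by (simp add: right_diff_distrib)
  also have "\<dots> = A * (g - s g - t g + s (t g) + t (s g) - s (t (s g)))"
    unfolding 2 3 by (simp add: algebra_simps)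
  finally have "A * B * (A + B) * (h2 - s h2) =
      A * (g - s g - t g + s (t g) + t (s g) - s (t (s g)))" .
  then have "A * (A * B * (A + B) * h3) = A * (g - s g - t g + s (t g) + t (s g) - s (t (s g)))"
    unfolding 1(3)[symmetric] by (simp add: mult_ac)
  moreover have "A \<noteq> 0" by (simp add: A)
  ultimately show ?thesis by (metis h1_def h2_def h3_def mult_left_cancel)
qed

text \<open>By the braid relation for exchanges of variables, both the alternating sum and the
  denominator are symmetric in the two indices.\<close>

lemma divided_diff_braid:
  "divided_diff i (divided_diff (i + 1) (divided_diff i g)) =
   divided_diff (i + 1) (divided_diff i (divided_diff (i + 1) g))"
proof -
  define A where "A = mvar i - mvar (i + 1)"
  define B where "B = mvar (i + 1) - mvar (i + 1 + 1)"
  have AB: "swap_vars i B = A + B" "swap_vars (i + 1) A = A + B" by (simp_all add: A_def B_def)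
  have "A * B * (A + B) * divided_diff i (divided_diff (i + 1) (divided_diff i g)) =
     B * A * (B + A) * divided_diff (i + 1) (divided_diff i (divided_diff (i + 1) g))"
    unfolding divided_diff_three[OF A_def B_def AB]
    using AB by (subst divided_diff_three[OF B_def A_def])
      (simp_all add: add.commute swap_vars_braid[simplified])
  moreover have "A * B * (A + B) \<noteq> 0" by (simp add: A_def B_def)
  ultimately show ?thesis by (metis mult_left_cancel mult.commute add.commute)
qed

section \<open>Derivations of the polynomial ring\<close>

text \<open>The derivation with \<open>x\<^sub>k \<mapsto> a k\<close>, read off from the first-order term of the substitution
  \<open>x\<^sub>k \<mapsto> x\<^sub>k + a k \<cdot> t\<close>.\<close>

definition mderiv :: "(nat \<Rightarrow> mpoly) \<Rightarrow> mpoly \<Rightarrow> mpoly" where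
  "mderiv a p = coeff (mpoly_subst (\<lambda>k. [:mvar k, a k:]) p) 1"

lemma mderiv_mvar [simp]: "mderiv a (mvar k) = a k"
  by (simp add: mderiv_def)

lemma mderiv_diff: "mderiv a (p - q) = mderiv a p - mderiv a q"
  by (simp add: mderiv_def mpoly_subst_diff)

lemma mderiv_one [simp]: "mderiv a 1 = 0"
  by (simp add: mderiv_def)

text \<open>The constant coefficient of the perturbed substitution is the polynomial itself, so the
  linear coefficient of a product obeys the Leibniz rule.\<close>

lemma mderiv_mult: "mderiv a (p * q) = mderiv a p * q + p * mderiv a q"
proof -
  have "coeff (mpoly_subst (\<lambda>k. [:mvar k, a k:]) r) 0 = mpoly_subst (\<lambda>k. coeff [:mvar k, a k:] 0) r" for r
    by (rule hom_mpoly_subst) (simp_all add: coeff_mult)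
  then show ?thesis
    by (simp add: mderiv_def mpoly_subst_mult coeff_mult mpoly_subst_mvar_id)
qed

lemma map_poly_hom:
  fixes F :: "'a::comm_ring_1 \<Rightarrow> 'b::comm_ring_1"
  assumes add: "\<And>x y. F (x + y) = F x + F y" and mult: "\<And>x y. F (x * y) = F x * F y"
    and one: "F 1 = 1"
  shows "map_poly F (mpoly_subst f p) = mpoly_subst (\<lambda>k. map_poly F (f k)) p"
proof -
  have zero: "F 0 = 0" using add[of 0 0] by simp
  have sum: "F (sum g A) = (\<Sum>x\<in>A. F (g x))" for g and A :: "nat set"
    by (induction A rule: infinite_finite_induct) (simp_all add: zero add)
  show ?thesis
    by (rule hom_mpoly_subst)
      (auto intro!: poly_eqI simp: coeff_map_poly zero add one mult coeff_mult sum map_poly_1)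
qed

text \<open>A homomorphism acts on the coefficients of the perturbed substitution. This describes
  \<open>mderiv\<close> after an exchange of variables and after evaluation at a point.\<close>

lemma hom_mderiv:
  fixes F :: "mpoly \<Rightarrow> 'b::comm_ring_1"
  assumes add: "\<And>x y. F (x + y) = F x + F y" and mult: "\<And>x y. F (x * y) = F x * F y"
    and one: "F 1 = 1"
  shows "F (mderiv a p) = coeff (mpoly_subst (\<lambda>k. [:F (mvar k), F (a k):]) p) 1"
proof -
  have zero: "F 0 = 0" using add[of 0 0] by simp
  have "F (mderiv a p) = coeff (map_poly F (mpoly_subst (\<lambda>k. [:mvar k, a k:]) p)) 1"
    by (simp add: mderiv_def coeff_map_poly zero)
  also have "\<dots> = coeff (mpoly_subst (\<lambda>k. [:F (mvar k), F (a k):]) p) 1"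
    unfolding map_poly_hom[of F, OF add mult one] by (simp add: map_poly_pCons zero)
  finally show ?thesis .
qed

text \<open>The hypothesis says that \<open>a\<close> is equivariant under the exchange; it holds
  for \<open>a k = 1\<close> and for \<open>a k = mvar k\<close>.\<close>

lemma mderiv_swap_vars:
  assumes "\<And>k. swap_vars i (a k) = a (simple_refl i k)"
  shows "mderiv a (swap_vars i p) = swap_vars i (mderiv a p)"
proof -
  have "swap_vars i (mderiv a p) = coeff (mpoly_subst (\<lambda>k. [:mvar (simple_refl i k), a (simple_refl i k):]) p) 1"
    by (subst hom_mderiv) (simp_all add: assms)
  then show ?thesis by (simp add: mderiv_def swap_vars_def mpoly_subst_mpoly_subst)
qed

text \<open>The sum of all partial derivatives.\<close>

definition grad :: "mpoly \<Rightarrow> mpoly" where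
  "grad = mderiv (\<lambda>_. 1)"

text \<open>The Euler operator, which multiplies a homogeneous polynomial by its degree.\<close>

definition euler :: "mpoly \<Rightarrow> mpoly" where
  "euler = mderiv mvar"

text \<open>\<open>grad\<close> kills \<open>mvar i - mvar (i + 1)\<close>, so differentiating the
  defining equation of a divided difference yields another such equation.\<close>

lemma grad_divided_diff: "grad (divided_diff i g) = divided_diff i (grad g)"
proof -
  have "grad ((mvar i - mvar (i + 1)) * divided_diff i g) = grad (g - swap_vars i g)"
    unfolding divided_diff ..
  then have "(mvar i - mvar (i + 1)) * grad (divided_diff i g) = grad g - swap_vars i (grad g)"
    by (simp add: grad_def mderiv_mult mderiv_diff mderiv_swap_vars)
  from divided_diff_unique[OF this] show ?thesis by simp
qed

text \<open>The eigenvalue equation encodes homogeneity; division by a linear form lowers the degree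
  by one.\<close>

lemma euler_divided_diff:
  assumes "euler g = of_nat (Suc d) * g"
  shows "euler (divided_diff i g) = of_nat d * divided_diff i g"
proof -
  let ?A = "mvar i - mvar (i + 1)"
  have "euler (?A * divided_diff i g) = euler (g - swap_vars i g)"
    unfolding divided_diff ..
  then have "?A * divided_diff i g + ?A * euler (divided_diff i g) = euler g - swap_vars i (euler g)"
    by (simp add: euler_def mderiv_mult mderiv_diff mderiv_swap_vars)
  also have "\<dots> = of_nat (Suc d) * (g - swap_vars i g)"
    unfolding assms by (simp add: algebra_simps)
  also have "\<dots> = of_nat (Suc d) * (?A * divided_diff i g)"
    unfolding divided_diff ..
  finally have "?A * euler (divided_diff i g) = ?A * (of_nat d * divided_diff i g)"
    by (simp add: algebra_simps)
  then show ?thesis using mvar_diff_nonzero by (metis mult_left_cancel)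
qed

text \<open>At the all-ones point both derivations are the first-order term of the same perturbation
  \<open>1 + t\<close>.\<close>

lemma mpoly_subst_one_grad: "mpoly_subst (\<lambda>_. 1 :: int) (grad p) = mpoly_subst (\<lambda>_. 1) (euler p)"
  unfolding grad_def euler_def
  by (subst (1 2) hom_mderiv) (simp_all add: mpoly_subst_add mpoly_subst_mult)

section \<open>Schubert polynomials\<close>

lemma coxeter_length_descent_iff:
  assumes w: "w permutes {1..n}" and i: "1 \<le> i" "i < n"
  shows "coxeter_length n (w \<circ> simple_refl i) < coxeter_length n w \<longleftrightarrow> w (i + 1) < w i"
  using permutes_comp_transpose(1)[OF w, of i "i + 1"] i inversions_simple_right[OF w i]
    permutes_lt_or_gt[OF w, of i "i + 1"]
    coxeter_length_eq_inversions[OF w] coxeter_length_eq_inversions[of "w \<circ> simple_refl i"]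
  by auto

lemma is_schubert_permutes: "is_schubert n w P \<Longrightarrow> w permutes {1..n}"
proof (induction rule: is_schubert.induct)
  case (descend w P i)
  then show ?case by (intro permutes_comp_transpose(1)) auto
qed (rule longest_perm_permutes)

lemma is_schubert_step:
  assumes "is_schubert n w P" "1 \<le> i" "i < n" "w (i + 1) < w i"
  shows "is_schubert n (w \<circ> simple_refl i) (divided_diff i P)"
  using assms is_schubert.descend coxeter_length_descent_iff[OF is_schubert_permutes] by blast

lemma comp_simple_refl_cancel: "w \<circ> transpose i j \<circ> transpose i j = w"
  by (simp add: comp_assoc)

text \<open>Reads the recursion backwards: its last step comes from the longer permutation reached
  at an ascent of \<open>w\<close>.\<close>

lemma is_schubert_cases:
  assumes "is_schubert n w P"
  obtains "w = longest_perm n" "P = (\<Prod>i = 1..n. mvar i ^ (n - i))"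
  | i R where "1 \<le> i" "i < n" "w i < w (i + 1)" "is_schubert n (w \<circ> simple_refl i) R"
      "P = divided_diff i R"
  using assms
proof (cases rule: is_schubert.cases)
  case (descend u R i)
  have u: "u permutes {1..n}" using descend is_schubert_permutes by blast
  have "u (i + 1) < u i" using coxeter_length_descent_iff[OF u] descend by simp
  moreover have "w \<circ> simple_refl i = u" using descend(1) by (simp add: comp_assoc)
  ultimately show ?thesis using that(2)[of i R] descend by simp
qed (use that in auto)

lemma exists_right_ascent:
  fixes n :: nat
  assumes w: "w permutes {1..n}" and "w \<noteq> longest_perm n"
  obtains i where "1 \<le> i" "i < n" "w i < w (i + 1)"
proof -
  obtain i where "1 \<le> i" "i < n" "\<not> w (i + 1) < w i"
    using permutes_decreasing_eq_longest[OF w] assms(2) by blast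
  then show ?thesis using that permutes_lt_or_gt[OF w, of i "i + 1"] by auto
qed

lemma is_schubert_exists:
  assumes "w permutes {1..n}"
  shows "\<exists>P. is_schubert n w P"
  using assms
proof (induction "(n choose 2) - inversions n w" arbitrary: w rule: less_induct)
  case less
  show ?case
  proof (cases "w = longest_perm n")
    case True
    then show ?thesis using is_schubert.longest by blast
  next
    case False
    then obtain i where i: "1 \<le> i" "i < n" "w i < w (i + 1)"
      using exists_right_ascent less.prems by blast
    let ?u = "w \<circ> simple_refl i"
    have u: "?u permutes {1..n}" using permutes_comp_transpose(1)[OF less.prems] i by simp
    have "inversions n ?u = inversions n w + 1" using inversions_simple_right(1)[OF less.prems i] .
    then obtain P where "is_schubert n ?u P" using less.hyps[OF _ u] inversions_le[of n ?u] by force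
    from is_schubert_step[OF this i(1,2)] i(3) show ?thesis by (auto simp: comp_simple_refl_cancel)
  qed
qed

text \<open>Induction downwards from the longest permutation. Two different last steps at
  \<open>i\<close> and \<open>j\<close> are continued up to a common permutation, \<open>w\<close>
  times the longest element of the subgroup generated by the two reflections. There the commutation
  or braid relation of divided differences makes the results agree.\<close>

lemma is_schubert_unique:
  assumes "is_schubert n w P" "is_schubert n w Q"
  shows "P = Q"
  using assms
proof (induction "(n choose 2) - inversions n w" arbitrary: w P Q rule: less_induct)
  case less
  have w: "w permutes {1..n}" using less.prems is_schubert_permutes by blast
  have IH: "R = R'" if "1 \<le> i" "i < n" "w i < w (i + 1)"
    "is_schubert n (w \<circ> simple_refl i) R" "is_schubert n (w \<circ> simple_refl i) R'" for i R R'
    using less.hyps[OF _ that(4,5)] inversions_simple_right(1)[OF w that(1-3)]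
      inversions_le[of n "w \<circ> simple_refl i"] by force
  have key: "divided_diff i R = divided_diff j R'"
    if i: "1 \<le> i" "i < n" "w i < w (i + 1)" "is_schubert n (w \<circ> simple_refl i) R"
      and j: "1 \<le> j" "j < n" "w j < w (j + 1)" "is_schubert n (w \<circ> simple_refl j) R'"
      and "i < j" for i j R R'
  proof (cases "j = i + 1")
    case False
    let ?u = "w \<circ> simple_refl i \<circ> simple_refl j"
    have c: "simple_refl i \<circ> simple_refl j = simple_refl j \<circ> simple_refl i"
      using False \<open>i < j\<close> by (auto simp: transpose_def fun_eq_iff)
    have "?u permutes {1..n}"
      by (intro permutes_comp_transpose(1) w) (use i j in auto)
    then obtain T where T: "is_schubert n ?u T" using is_schubert_exists by blast
    have "is_schubert n (?u \<circ> simple_refl j) (divided_diff j T)"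
      by (rule is_schubert_step[OF T]) (use i j False \<open>i < j\<close> in auto)
    then have R: "R = divided_diff j T" using IH i by (simp add: comp_simple_refl_cancel)
    have "?u \<circ> simple_refl i = w \<circ> simple_refl j"
      unfolding comp_assoc c by (simp add: comp_assoc[symmetric] comp_simple_refl_cancel)
    moreover have "is_schubert n (?u \<circ> simple_refl i) (divided_diff i T)"
      by (rule is_schubert_step[OF T]) (use i j False \<open>i < j\<close> in auto)
    ultimately have "R' = divided_diff i T" using IH j by simp
    then show ?thesis using R divided_diff_commute[of i j T] False \<open>i < j\<close> by simp
  next
    case True
    let ?s = "simple_refl i" and ?t = "simple_refl (i + 1)"
    \<comment> \<open>\<open>?u\<close> has the three increasing entries at \<open>i\<close>,
      \<open>i + 1\<close>, \<open>i + 2\<close> in reverse order; both reduced words of that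
      reversal lead down to \<open>w\<close>.\<close>
    let ?u = "w \<circ> ?s \<circ> ?t \<circ> ?s"
    have c: "?s \<circ> ?t \<circ> ?s = ?t \<circ> ?s \<circ> ?t" by (auto simp: transpose_def fun_eq_iff)
    have lt: "w i < w (i + 1)" "w (i + 1) < w (i + 2)" using i j True by auto
    have "?u permutes {1..n}"
      by (intro permutes_comp_transpose(1) w) (use i j True in auto)
    then obtain T where T: "is_schubert n ?u T" using is_schubert_exists by blast
    have "is_schubert n (?u \<circ> ?s) (divided_diff i T)"
      by (rule is_schubert_step[OF T]) (use i lt in auto)
    then have "is_schubert n (w \<circ> ?s \<circ> ?t) (divided_diff i T)" by (simp add: comp_simple_refl_cancel)
    then have "is_schubert n (w \<circ> ?s \<circ> ?t \<circ> ?t) (divided_diff (i + 1) (divided_diff i T))"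
      by (rule is_schubert_step) (use i j True lt in auto)
    then have R: "R = divided_diff (i + 1) (divided_diff i T)"
      using IH[of i] i by (simp add: comp_simple_refl_cancel)
    have "is_schubert n (?u \<circ> ?t) (divided_diff (i + 1) T)"
      by (rule is_schubert_step[OF T]) (use i j True lt in auto)
    moreover have e: "?u = w \<circ> ?t \<circ> ?s \<circ> ?t" using c by (metis comp_assoc)
    have "?u \<circ> ?t = w \<circ> ?t \<circ> ?s"
      unfolding e by (rule comp_simple_refl_cancel)
    ultimately have "is_schubert n (w \<circ> ?t \<circ> ?s) (divided_diff (i + 1) T)" by simp
    then have "is_schubert n (w \<circ> ?t \<circ> ?s \<circ> ?s) (divided_diff i (divided_diff (i + 1) T))"
      by (rule is_schubert_step) (use i j True lt in auto)
    then have "R' = divided_diff i (divided_diff (i + 1) T)"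
      using IH[of "i + 1"] j True by (simp add: comp_simple_refl_cancel)
    then show ?thesis using R True divided_diff_braid[of i T] by simp
  qed
  show ?case
  proof (cases rule: is_schubert_cases[OF less.prems(1)])
    case 1
    have False if "1 \<le> i" "i < n" "w i < w (i + 1)" for i
      using that by (simp add: 1 longest_perm_def split: if_splits)
    then show ?thesis using 1 by (cases rule: is_schubert_cases[OF less.prems(2)]) auto
  next
    case i: (2 i R)
    show ?thesis
    proof (cases rule: is_schubert_cases[OF less.prems(2)])
      case 1
      then show ?thesis using i(1-3) by (simp add: longest_perm_def split: if_splits)
    next
      case j: (2 j R')
      consider "i < j" | "i = j" | "j < i" by linarith
      then show ?thesis
      proof cases
        case 1
        then show ?thesis unfolding i(5) j(5) by (rule key[OF i(1-4) j(1-4)])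
      next
        case 2
        have "R = R'" by (rule IH[OF i(1-4)]) (use j 2 in simp)
        then show ?thesis using i(5) j(5) 2 by simp
      next
        case 3
        then show ?thesis unfolding i(5) j(5) by (rule key[OF j(1-4) i(1-4), symmetric])
      qed
    qed
  qed
qed

lemma schubert_eq: "is_schubert n w P \<Longrightarrow> schubert n w = P"
  unfolding schubert_def using is_schubert_unique by blast

lemma is_schubert_schubert: "w permutes {1..n} \<Longrightarrow> is_schubert n w (schubert n w)"
  using is_schubert_exists schubert_eq by blast

text \<open>At an ascent \<open>schubert n w\<close> is itself a divided difference at the same
  \<open>i\<close>, and divided differences square to zero.\<close>

lemma divided_diff_schubert:
  assumes w: "w permutes {1..n}" and i: "1 \<le> i" "i < n"
  shows "divided_diff i (schubert n w) = (if w (i + 1) < w i then schubert n (w \<circ> simple_refl i) else 0)"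
proof (cases "w (i + 1) < w i")
  case True
  show ?thesis
    using schubert_eq[OF is_schubert_step[OF is_schubert_schubert[OF w] i True]] True by simp
next
  case False
  let ?u = "w \<circ> simple_refl i"
  have u: "?u permutes {1..n}" using permutes_comp_transpose(1)[OF w] i by simp
  have "?u (i + 1) < ?u i" using False permutes_lt_or_gt[OF w, of i "i + 1"] by auto
  then have "is_schubert n (?u \<circ> simple_refl i) (divided_diff i (schubert n ?u))"
    by (rule is_schubert_step[OF is_schubert_schubert[OF u] i])
  then have "schubert n w = divided_diff i (schubert n ?u)"
    unfolding comp_simple_refl_cancel by (rule schubert_eq)
  then show ?thesis using False by simp
qed

section \<open>Degree and total derivative of Schubert polynomials\<close>

lemma mderiv_prod:
  "finite A \<Longrightarrow> mderiv a (\<Prod>i\<in>A. f i) = (\<Sum>j\<in>A. mderiv a (f j) * (\<Prod>i\<in>A - {j}. f i))"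
proof (induction A rule: finite_induct)
  case (insert x A)
  have "(\<Prod>i\<in>insert x A - {j}. f i) = f x * (\<Prod>i\<in>A - {j}. f i)" if "j \<in> A" for j
  proof -
    have "insert x A - {j} = insert x (A - {j})" using insert that by auto
    then show ?thesis using insert by simp
  qed
  moreover have "insert x A - {x} = A" using insert by auto
  ultimately show ?case using insert
    by (simp add: mderiv_mult sum_distrib_left mult_ac cong: sum.cong)
qed simp

lemma mderiv_mvar_power: "mderiv a (mvar i ^ k) = of_nat k * a i * mvar i ^ (k - 1)"
proof (induction k)
  case (Suc k)
  then show ?case by (cases k) (simp_all add: mderiv_mult algebra_simps)
qed simp

lemma sum_diff_eq_choose: "(\<Sum>i = 1..n. n - i) = n choose 2" for n :: nat
proof -
  have "(\<Sum>i = 1..n. n - i) = (\<Sum>i<n. i)"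
    by (rule sum.reindex_bij_witness[of _ "\<lambda>i. n - i" "\<lambda>i. n - i"]) auto
  also have "\<dots> = n choose 2"
    by (induction n) (auto simp: numeral_2_eq_2)
  finally show ?thesis .
qed

text \<open>The exponents of the initial monomial add up to \<open>n choose 2\<close>, and each
  divided difference lowers degree and length by one.\<close>

lemma euler_is_schubert: "is_schubert n w P \<Longrightarrow> euler P = of_nat (inversions n w) * P"
proof (induction rule: is_schubert.induct)
  case longest
  have pow: "euler (mvar i ^ k) = of_nat k * mvar i ^ k" for i k
    by (induction k) (simp_all add: euler_def mderiv_mult algebra_simps)
  have "euler (\<Prod>i\<in>A. mvar i ^ e i) = of_nat (\<Sum>i\<in>A. e i) * (\<Prod>i\<in>A. mvar i ^ e i)"
    if "finite A" for A e
    using that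
    by (induction A rule: finite_induct)
      (simp_all add: euler_def mderiv_mult pow[unfolded euler_def] algebra_simps)
  then show ?case by (simp only: finite_atLeastAtMost inversions_longest sum_diff_eq_choose)
next
  case (descend w P i)
  have w: "w permutes {1..n}" using descend is_schubert_permutes by blast
  then have "w (i + 1) < w i" using coxeter_length_descent_iff descend by blast
  then have L: "inversions n w = Suc (inversions n (w \<circ> simple_refl i))"
    using inversions_simple_right(2)[OF w] descend by simp
  show ?case by (rule euler_divided_diff) (simp only: descend.IH L)
qed

text \<open>In one-line notation, \<open>k + 1\<close> stands to the left of \<open>k\<close>;
  equivalently, \<open>simple_refl k \<circ> w\<close> is shorter than \<open>w\<close>.\<close>

definition left_descents :: "nat \<Rightarrow> (nat \<Rightarrow> nat) \<Rightarrow> nat set" where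
  "left_descents n w = {k. 1 \<le> k \<and> k < n \<and> inv w (k + 1) < inv w k}"

lemma finite_left_descents [simp]: "finite (left_descents n w)"
  by (rule finite_subset[of _ "{..<n}"]) (auto simp: left_descents_def)

lemma inversions_left_descent:
  assumes "w permutes {1..n}" "k \<in> left_descents n w"
  shows "inversions n w = inversions n (simple_refl k \<circ> w) + 1"
  using inversions_simple_left(2)[OF assms(1)] assms(2) by (auto simp: left_descents_def)

lemma inversions_not_left_descent:
  assumes w: "w permutes {1..n}" and "k \<notin> left_descents n w" "1 \<le> k" "k < n"
  shows "inversions n (simple_refl k \<circ> w) = inversions n w + 1"
  using inversions_simple_left(1)[OF w assms(3,4)] permutes_lt_or_gt[OF permutes_inv[OF w], of k "k + 1"] assms
  by (auto simp: left_descents_def)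

lemma left_descents_iff:
  assumes w: "w permutes {1..n}" and "1 \<le> k" "k < n"
  shows "k \<in> left_descents n w \<longleftrightarrow> inversions n (simple_refl k \<circ> w) < inversions n w"
  using inversions_left_descent[OF w] inversions_not_left_descent[OF w] assms by force

lemma inversions_right_iff:
  assumes w: "w permutes {1..n}" and i: "1 \<le> i" "i < n"
  shows "w (i + 1) < w i \<longleftrightarrow> inversions n (w \<circ> simple_refl i) < inversions n w"
  using inversions_simple_right[OF w i] permutes_lt_or_gt[OF w, of i "i + 1"] by auto

text \<open>Both sides say that \<open>simple_refl k \<circ> w \<circ> simple_refl i\<close> is
  shorter than \<open>w\<close> by two.\<close>

lemma left_descents_right_descent:
  assumes w: "w permutes {1..n}" and i: "1 \<le> i" "i < n" and d: "w (i + 1) < w i"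
  shows "left_descents n (w \<circ> simple_refl i) =
    {k \<in> left_descents n w. (simple_refl k \<circ> w) (i + 1) < (simple_refl k \<circ> w) i}"
proof -
  let ?v = "w \<circ> simple_refl i"
  have v: "?v permutes {1..n}" using permutes_comp_transpose(1)[OF w] i by simp
  have Lv: "inversions n w = inversions n ?v + 1" using inversions_simple_right(2)[OF w i d] .
  have "k \<in> left_descents n ?v \<longleftrightarrow>
      k \<in> left_descents n w \<and> (simple_refl k \<circ> w) (i + 1) < (simple_refl k \<circ> w) i"
    if k: "1 \<le> k" "k < n" for k
  proof -
    let ?u = "simple_refl k \<circ> w"
    have u: "?u permutes {1..n}" using permutes_comp_transpose(2)[OF w] k by simp
    have e: "simple_refl k \<circ> ?v = ?u \<circ> simple_refl i" by (simp add: comp_assoc)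
    show ?thesis
      using left_descents_iff[OF v k] left_descents_iff[OF w k] inversions_right_iff[OF u i]
        inversions_left_descent[OF v, of k] inversions_not_left_descent[OF v _ k]
        inversions_left_descent[OF w, of k] inversions_not_left_descent[OF w _ k]
        inversions_simple_right[OF u i] permutes_lt_or_gt[OF u, of i "i + 1"] Lv
      unfolding e by linarith
  qed
  then show ?thesis by (auto simp: left_descents_def)
qed

text \<open>The monomial is \<open>mvar j\<close> times a factor in which the variables
  \<open>j\<close> and \<open>j + 1\<close> have equal exponents, so that the exchange fixes this
  factor.\<close>

lemma divided_diff_longest:
  assumes j: "1 \<le> j" "j < n"
  shows "divided_diff j (\<Prod>i = 1..n. mvar i ^ (n - i)) =
    mvar j ^ (n - j - 1) * (\<Prod>i\<in>{1..n} - {j}. mvar i ^ (n - i))"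
proof (rule divided_diff_unique)
  let ?P = "\<Prod>i = 1..n. mvar i ^ (n - i)"
  define Q where "Q = mvar j ^ (n - j - 1) * (\<Prod>i\<in>{1..n} - {j}. mvar i ^ (n - i))"
  define e where "e = (\<lambda>i. if i = j then n - j - 1 else n - i)"
  have "(\<Prod>i = 1..n. mvar i ^ e i) = mvar j ^ e j * (\<Prod>i\<in>{1..n} - {j}. mvar i ^ e i)"
    by (rule prod.remove) (use j in auto)
  also have "\<dots> = Q" by (simp add: e_def Q_def)
  finally have Q: "Q = (\<Prod>i = 1..n. mvar i ^ e i)" ..
  have "swap_vars j (\<Prod>i = 1..n. mvar i ^ e i) = (\<Prod>i = 1..n. mvar (simple_refl j i) ^ e i)"
    by simp
  also have "\<dots> = (\<Prod>i = 1..n. mvar i ^ e i)"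
    by (rule prod.reindex_bij_witness[of _ "simple_refl j" "simple_refl j"])
      (use j in \<open>auto simp: transpose_def e_def split: if_splits\<close>)
  finally have sQ: "swap_vars j Q = Q" unfolding Q .
  have "?P = mvar j ^ (n - j) * (\<Prod>i\<in>{1..n} - {j}. mvar i ^ (n - i))"
    by (rule prod.remove) (use j in auto)
  also have "mvar j ^ (n - j) = mvar j * mvar j ^ (n - j - 1)"
    using j by (simp flip: power_Suc add: Suc_diff_Suc)
  finally have P: "?P = mvar j * Q" by (simp only: mult.assoc Q_def)
  have sP: "swap_vars j ?P = mvar (j + 1) * Q" unfolding P swap_vars_simps(6) sQ by simp
  show "(mvar j - mvar (j + 1)) * (mvar j ^ (n - j - 1) * (\<Prod>i\<in>{1..n} - {j}. mvar i ^ (n - i))) =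
      ?P - swap_vars j ?P"
    unfolding Q_def[symmetric] sP left_diff_distrib by (simp only: P)
qed

text \<open>For the longest permutation, the partial derivative in variable \<open>j\<close> is
  \<open>n - j\<close> times the divided difference at \<open>j\<close>. Going down, the divided
  difference is applied to both sides, and it kills the summands for which \<open>i\<close> is not a
  right descent of \<open>simple_refl k \<circ> w\<close>.\<close>

lemma grad_is_schubert:
  "is_schubert n w P \<Longrightarrow> grad P = (\<Sum>k\<in>left_descents n w. of_nat k * schubert n (simple_refl k \<circ> w))"
proof (induction rule: is_schubert.induct)
  case longest
  let ?P = "\<Prod>i = 1..n. mvar i ^ (n - i)"
  let ?w = "longest_perm n"
  have iw: "inv ?w = ?w" using longest_perm_comp_self by (rule inv_unique_comp) (rule longest_perm_comp_self)
  have D: "left_descents n ?w = {1..<n}" by (auto simp: left_descents_def iw longest_perm_def)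
  have S: "schubert n (simple_refl k \<circ> ?w) = divided_diff (n - k) ?P" if "k \<in> {1..<n}" for k
  proof -
    have "schubert n ?w = ?P" by (rule schubert_eq) (rule is_schubert.longest)
    \<comment> \<open>The longest permutation conjugates the reflection at \<open>k\<close> into the
      one at \<open>n - k\<close>, turning left multiplication into right multiplication.\<close>
    moreover have "simple_refl k \<circ> ?w = ?w \<circ> simple_refl (n - k)"
      using that transpose_comp_eq[OF permutes_bij[OF longest_perm_permutes[of n]], of k "k + 1"]
      by (auto simp: iw longest_perm_def Suc_diff_le transpose_commute)
    moreover have "1 \<le> n - k" "n - k < n" using that by auto
    moreover have "?w (n - k + 1) < ?w (n - k)" using that by (auto simp: longest_perm_def)
    ultimately show ?thesis
      using divided_diff_schubert[OF longest_perm_permutes, of "n - k" n] by simp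
  qed
  have "grad ?P = (\<Sum>j = 1..n. of_nat (n - j) * mvar j ^ (n - j - 1) * (\<Prod>i\<in>{1..n} - {j}. mvar i ^ (n - i)))"
    unfolding grad_def by (subst mderiv_prod) (simp_all add: mderiv_mvar_power)
  also have "\<dots> = (\<Sum>j\<in>{1..<n}. of_nat (n - j) * mvar j ^ (n - j - 1) * (\<Prod>i\<in>{1..n} - {j}. mvar i ^ (n - i)))"
    by (rule sum.mono_neutral_right) (auto simp: not_less)
  also have "\<dots> = (\<Sum>j\<in>{1..<n}. of_nat (n - j) * divided_diff j ?P)"
    by (rule sum.cong) (use divided_diff_longest in \<open>auto simp: mult.assoc\<close>)
  also have "\<dots> = (\<Sum>k\<in>{1..<n}. of_nat k * divided_diff (n - k) ?P)"
    by (rule sum.reindex_bij_witness[of _ "\<lambda>i. n - i" "\<lambda>i. n - i"]) auto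
  also have "\<dots> = (\<Sum>k\<in>{1..<n}. of_nat k * schubert n (simple_refl k \<circ> ?w))"
    by (rule sum.cong) (simp_all only: S)
  finally show ?case unfolding D .
next
  case (descend w P i)
  have w: "w permutes {1..n}" using descend is_schubert_permutes by blast
  then have d: "w (i + 1) < w i" using coxeter_length_descent_iff descend by blast
  note i = descend(2,3)
  have "divided_diff i (schubert n (simple_refl k \<circ> w)) =
      (if (simple_refl k \<circ> w) (i + 1) < (simple_refl k \<circ> w) i
       then schubert n (simple_refl k \<circ> (w \<circ> simple_refl i)) else 0)" if "k \<in> left_descents n w" for k
  proof -
    have "simple_refl k \<circ> w permutes {1..n}"
      using permutes_comp_transpose(2)[OF w] that by (simp add: left_descents_def)
    from divided_diff_schubert[OF this i] show ?thesis by (simp only: comp_assoc)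
  qed
  then have "grad (divided_diff i P) = (\<Sum>k\<in>left_descents n w. of_nat k *
      (if (simple_refl k \<circ> w) (i + 1) < (simple_refl k \<circ> w) i
       then schubert n (simple_refl k \<circ> (w \<circ> simple_refl i)) else 0))"
    unfolding grad_divided_diff descend.IH divided_diff_sum by (intro sum.cong) simp_all
  also have "\<dots> = (\<Sum>k\<in>left_descents n (w \<circ> simple_refl i).
      of_nat k * schubert n (simple_refl k \<circ> (w \<circ> simple_refl i)))"
    unfolding left_descents_right_descent[OF w i d]
    by (rule sum.mono_neutral_cong_right) auto
  finally show ?case .
qed

section \<open>Values at the all-ones point and reduced words\<close>

definition schubert_one :: "nat \<Rightarrow> (nat \<Rightarrow> nat) \<Rightarrow> int" where
  "schubert_one n w = mpoly_subst (\<lambda>_. 1) (schubert n w)"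

text \<open>Evaluates \<open>euler\<close> and \<open>grad\<close> of \<open>schubert n w\<close> at
  the all-ones point, where they agree.\<close>

lemma schubert_one_left_descents:
  assumes "w permutes {1..n}"
  shows "int (inversions n w) * schubert_one n w =
    (\<Sum>k\<in>left_descents n w. int k * schubert_one n (simple_refl k \<circ> w))"
  using mpoly_subst_one_grad[of "schubert n w"] is_schubert_schubert[OF assms]
  by (simp add: euler_is_schubert grad_is_schubert mpoly_subst_mult mpoly_subst_sum
      mpoly_subst_of_nat schubert_one_def)

lemma schubert_one_longest: "schubert_one n (longest_perm n) = 1"
  by (simp add: schubert_one_def schubert_eq[OF is_schubert.longest] mpoly_subst_prod mpoly_subst_power)

definition reduced_words :: "nat \<Rightarrow> (nat \<Rightarrow> nat) \<Rightarrow> nat list set" where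
  "reduced_words n w = {is. set is \<subseteq> {1..<n} \<and> length is = inversions n w \<and> word_prod is = w}"

lemma finite_reduced_words [simp]: "finite (reduced_words n w)"
  by (rule finite_subset[OF _ finite_lists_length_eq[of "{1..<n}" "inversions n w"]])
    (auto simp: reduced_words_def)

text \<open>The first letter of a reduced word is a left descent, and the remaining letters form a
  reduced word again.\<close>

lemma reduced_words_left_descents:
  assumes w: "w permutes {1..n}" and "w \<noteq> id"
  shows "reduced_words n w =
    (\<lambda>(k, js). k # js) ` (SIGMA k:left_descents n w. reduced_words n (simple_refl k \<circ> w))"
proof (intro equalityI subsetI)
  fix "is" assume a: "is \<in> reduced_words n w"
  with \<open>w \<noteq> id\<close> obtain k js where kj: "is = k # js" by (cases "is") (auto simp: reduced_words_def)
  have k: "1 \<le> k" "k < n" and js: "set js \<subseteq> {1..<n}" "length js + 1 = inversions n w"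
    and wp: "simple_refl k \<circ> word_prod js = w"
    using a unfolding kj reduced_words_def mem_Collect_eq word_prod_simps by auto
  have u: "word_prod js = simple_refl k \<circ> w" by (simp add: wp[symmetric] comp_assoc[symmetric])
  have "inversions n (simple_refl k \<circ> w) \<le> length js" using inversions_word_prod_le[OF js(1)] u by simp
  then have d: "k \<in> left_descents n w" using left_descents_iff[OF w k] js by simp
  from inversions_left_descent[OF w d] js u d
  show "is \<in> (\<lambda>(k, js). k # js) ` (SIGMA k:left_descents n w. reduced_words n (simple_refl k \<circ> w))"
    by (intro image_eqI[of _ _ "(k, js)"]) (auto simp: kj reduced_words_def)
next
  fix "is" assume "is \<in> (\<lambda>(k, js). k # js) ` (SIGMA k:left_descents n w. reduced_words n (simple_refl k \<circ> w))"
  then obtain k js where kj: "is = k # js" "k \<in> left_descents n w" "js \<in> reduced_words n (simple_refl k \<circ> w)"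
    by auto
  have "simple_refl k \<circ> word_prod js = w"
    using kj(3) by (simp add: reduced_words_def comp_assoc[symmetric])
  then show "is \<in> reduced_words n w"
    using kj inversions_left_descent[OF w kj(2)]
    unfolding reduced_words_def mem_Collect_eq kj(1) word_prod_simps by (auto simp: left_descents_def)
qed

text \<open>Macdonald's reduced word identity, up to the constant \<^term>\<open>schubert_one n id\<close>.\<close>

lemma schubert_one_reduced_words:
  assumes "w permutes {1..n}"
  shows "fact (inversions n w) * schubert_one n w =
    (\<Sum>is\<in>reduced_words n w. int (prod_list is)) * schubert_one n id"
  using assms
proof (induction "inversions n w" arbitrary: w rule: less_induct)
  case less
  show ?case
  proof (cases "w = id")
    case True
    have "reduced_words n id = {[]}" by (auto simp: reduced_words_def)
    then show ?thesis using True by simp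
  next
    case False
    obtain k where "k \<in> left_descents n w"
      using exists_left_descent[OF less.prems False] by (auto simp: left_descents_def)
    then obtain l where l: "inversions n w = Suc l"
      using inversions_left_descent[OF less.prems] by simp
    have IH: "fact l * schubert_one n (simple_refl k \<circ> w) =
        (\<Sum>is\<in>reduced_words n (simple_refl k \<circ> w). int (prod_list is)) * schubert_one n id"
      if k: "k \<in> left_descents n w" for k
    proof -
      have "simple_refl k \<circ> w permutes {1..n}"
        using permutes_comp_transpose(2)[OF less.prems] k by (simp add: left_descents_def)
      moreover have "inversions n (simple_refl k \<circ> w) = l"
        using inversions_left_descent[OF less.prems k] l by simp
      ultimately show ?thesis using less.hyps[of "simple_refl k \<circ> w"] l by simp
    qed
    have "fact (inversions n w) * schubert_one n w = fact l * (int (inversions n w) * schubert_one n w)"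
      unfolding l by (simp add: algebra_simps)
    also have "\<dots> = (\<Sum>k\<in>left_descents n w. int k * (fact l * schubert_one n (simple_refl k \<circ> w)))"
      unfolding schubert_one_left_descents[OF less.prems] by (simp add: sum_distrib_left mult_ac)
    also have "\<dots> = (\<Sum>k\<in>left_descents n w. int k *
        ((\<Sum>is\<in>reduced_words n (simple_refl k \<circ> w). int (prod_list is)) * schubert_one n id))"
      by (rule sum.cong) (simp_all only: IH)
    also have "\<dots> = (\<Sum>k\<in>left_descents n w. \<Sum>js\<in>reduced_words n (simple_refl k \<circ> w).
        int (prod_list (k # js))) * schubert_one n id"
      by (simp add: sum_distrib_left sum_distrib_right mult_ac)
    also have "(\<Sum>k\<in>left_descents n w. \<Sum>js\<in>reduced_words n (simple_refl k \<circ> w). int (prod_list (k # js))) =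
        (\<Sum>is\<in>reduced_words n w. int (prod_list is))"
      unfolding reduced_words_left_descents[OF less.prems False]
      by (subst sum.reindex) (auto simp: inj_on_def sum.Sigma split_def)
    finally show ?thesis .
  qed
qed

lemma word_prod_append: "word_prod (xs @ ys) = word_prod xs \<circ> word_prod ys"
  by (induction xs) (simp_all only: append.simps word_prod_simps id_comp comp_assoc)

lemma word_prod_rev: "word_prod (rev is) = inv (word_prod is)"
proof (rule sym, rule inv_unique_comp)
  have *: "word_prod js \<circ> word_prod (rev js) = id" for js
  proof (induction js)
    case (Cons k js)
    have "word_prod (k # js) \<circ> word_prod (rev (k # js)) =
        simple_refl k \<circ> (word_prod js \<circ> word_prod (rev js)) \<circ> simple_refl k"
      unfolding rev.simps word_prod_append word_prod_simps by (simp add: comp_assoc)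
    then show ?case unfolding Cons comp_id transpose_comp_involutory .
  qed simp
  show "word_prod is \<circ> word_prod (rev is) = id" "word_prod (rev is) \<circ> word_prod is = id"
    using *[of "is"] *[of "rev is"] by simp_all
qed

text \<open>Reversal maps reduced words of \<open>w\<close> to those of its inverse and keeps the
  product of the letters; the factor \<open>schubert_one n id\<close> is common to both
  sides.\<close>

lemma schubert_one_inv:
  assumes w: "w permutes {1..n}"
  shows "schubert_one n (inv w) = schubert_one n w"
proof -
  have rev: "rev is \<in> reduced_words n (inv u)" if "u permutes {1..n}" "is \<in> reduced_words n u" for u "is"
    using that by (simp add: reduced_words_def word_prod_rev inversions_inv)
  have "(\<Sum>is\<in>reduced_words n (inv w). int (prod_list is)) = (\<Sum>is\<in>reduced_words n w. int (prod_list is))"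
    by (rule sum.reindex_bij_witness[of _ rev rev])
      (use rev[OF w] rev[OF permutes_inv[OF w]] in \<open>auto simp: inv_inv_eq permutes_bij[OF w] prod_list.rev\<close>)
  then have "fact (inversions n w) * schubert_one n (inv w) = fact (inversions n w) * schubert_one n w"
    using schubert_one_reduced_words[OF w] schubert_one_reduced_words[OF permutes_inv[OF w]]
    by (simp add: inversions_inv[OF w])
  then show ?thesis by simp
qed

section \<open>The commutation relation\<close>

definition covers :: "nat \<Rightarrow> (nat \<Rightarrow> nat) \<Rightarrow> (nat \<times> nat) set" where
  "covers n w = {(i, j). 1 \<le> i \<and> i < j \<and> j \<le> n \<and> w i < w j \<and>
     (\<forall>m. i < m \<and> m < j \<longrightarrow> \<not> (w i < w m \<and> w m < w j))}"

text \<open>The statistic \<open>b\<close> of a cover, with its positions made explicit.\<close>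

definition exceed_between :: "(nat \<Rightarrow> nat) \<Rightarrow> nat \<Rightarrow> nat \<Rightarrow> nat" where
  "exceed_between w i j = card {k. i < k \<and> k < j \<and> w j < w k}"

text \<open>The statistic \<open>c\<close> of a cover, with its positions made explicit.\<close>

definition between_after :: "nat \<Rightarrow> (nat \<Rightarrow> nat) \<Rightarrow> nat \<Rightarrow> nat \<Rightarrow> nat" where
  "between_after n w i j = card {k. j < k \<and> k \<le> n \<and> w i < w k \<and> w k < w j}"

lemma finite_covers [simp]: "finite (covers n w)"
  unfolding covers_def by (rule finite_inversion_pairs)

text \<open>The correction term of \<open>inversions_transpose\<close> vanishes exactly when no
  entry lies between in position and value; if \<open>w j < w i\<close>, the exchange loses
  inversions.\<close>

lemma covers_iff:
  assumes w: "w permutes {1..n}" and ij: "1 \<le> i" "i < j" "j \<le> n"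
  shows "(i, j) \<in> covers n w \<longleftrightarrow> inversions n (w \<circ> transpose i j) = inversions n w + 1"
proof (cases "w i < w j")
  case True
  have "finite {m. i < m \<and> m < j \<and> w i < w m \<and> w m < w j}"
    by (rule finite_subset[of _ "{..j}"]) auto
  then show ?thesis
    using inversions_transpose[OF w ij True] ij True by (auto simp: covers_def)
next
  case False
  then have lt: "(w \<circ> transpose i j) i < (w \<circ> transpose i j) j"
    using permutes_lt_or_gt[OF w, of i j] ij by auto
  have "w \<circ> transpose i j permutes {1..n}" using permutes_comp_transpose(1)[OF w] ij by simp
  then show ?thesis
    using inversions_transpose[of "w \<circ> transpose i j" n i j, OF _ ij lt] False
    unfolding comp_simple_refl_cancel by (simp add: covers_def)
qed

lemma simple_refl_comp_eq:
  "w permutes {1..n} \<Longrightarrow> simple_refl k \<circ> w = w \<circ> transpose (inv w k) (inv w (k + 1))"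
  by (rule transpose_comp_eq[OF permutes_bij])

lemma inv_comp_transpose:
  "w permutes {1..n} \<Longrightarrow> inv (w \<circ> transpose i j) = transpose i j \<circ> inv w"
  by (simp add: o_inv_distrib permutes_bij)

lemma inv_transpose_comp:
  "w permutes {1..n} \<Longrightarrow> inv (transpose i j \<circ> w) = inv w \<circ> transpose i j"
  by (simp add: o_inv_distrib permutes_bij)

text \<open>An instance of the lifting property of the Bruhat order; the conclusion amounts to
  \<open>w t = s\<^sub>k w\<close>.\<close>

lemma cover_lifting:
  assumes w: "w permutes {1..n}" and e: "(i, j) \<in> covers n w"
    and k: "k \<notin> left_descents n w" and kt: "k \<in> left_descents n (w \<circ> transpose i j)"
  shows "i = inv w k" "j = inv w (k + 1)"
proof -
  define p q where "p = inv w k" and "q = inv w (k + 1)"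
  have wp: "w p = k" "w q = k + 1" using permutes_inverses(1)[OF w] by (simp_all add: p_def q_def)
  have "1 \<le> k" "k < n" using kt by (auto simp: left_descents_def)
  then have "p < q"
    using k permutes_lt_or_gt[OF permutes_inv[OF w], of k "k + 1"] by (auto simp: left_descents_def p_def q_def)
  have t: "transpose i j q < transpose i j p"
    using kt by (auto simp: left_descents_def inv_comp_transpose[OF w] p_def q_def)
  have ij: "i < j" "w i < w j" and no: "\<And>m. i < m \<Longrightarrow> m < j \<Longrightarrow> w i < w m \<Longrightarrow> \<not> w m < w j"
    using e by (auto simp: covers_def)
  have inj: "w a = w b \<longleftrightarrow> a = b" for a b using permutes_inj[OF w] by (simp add: inj_eq)
  have "i = p \<and> j = q"
  \<comment> \<open>The exchange must reverse the order of the entries \<open>k\<close> and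
    \<open>k + 1\<close>, so it moves at least one of them. If it moved only one, the other would
    lie inside the cover in position and value.\<close>
  proof (cases "i = p")
    case True
    have "j = q"
    proof (rule ccontr)
      assume "j \<noteq> q"
      then have "q < j" using t True \<open>p < q\<close> ij by (simp add: transpose_def)
      moreover have "w j \<noteq> k + 1" using \<open>j \<noteq> q\<close> wp inj by metis
      ultimately show False using no[of q] True \<open>p < q\<close> ij wp by simp
    qed
    with True show ?thesis by simp
  next
    case False
    have "j = q" using t False \<open>p < q\<close> ij by (simp add: transpose_def split: if_splits)
    then have "i < p" using t False \<open>p < q\<close> ij by (simp add: transpose_def)
    moreover have "w i \<noteq> k" using False wp inj by metis
    ultimately show ?thesis using no[of p] \<open>j = q\<close> \<open>p < q\<close> ij wp by simp
  qed
  then show "i = inv w k" "j = inv w (k + 1)" by (simp_all add: p_def q_def)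
qed

text \<open>Supplies the diagonal pairs: at a left ascent, \<open>simple_refl k \<circ> w\<close>
  arises from \<open>w\<close> by a cover and leads back down to \<open>w\<close>.\<close>

lemma cover_left_ascent:
  assumes w: "w permutes {1..n}" and k: "1 \<le> k" "k < n" "k \<notin> left_descents n w"
  shows "(inv w k, inv w (k + 1)) \<in> covers n w"
    and "k \<in> left_descents n (simple_refl k \<circ> w)"
proof -
  have p: "inv w a \<in> {1..n} \<longleftrightarrow> a \<in> {1..n}" for a
    using permutes_in_image[OF permutes_inv[OF w]] .
  have lt: "inv w k < inv w (k + 1)"
    using k permutes_lt_or_gt[OF permutes_inv[OF w], of k "k + 1"] by (auto simp: left_descents_def)
  have "inversions n (w \<circ> transpose (inv w k) (inv w (k + 1))) = inversions n w + 1"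
    unfolding simple_refl_comp_eq[OF w, symmetric] using inversions_not_left_descent[OF w k(3,1,2)] .
  then show "(inv w k, inv w (k + 1)) \<in> covers n w"
    using covers_iff[OF w _ lt] p[of k] p[of "k + 1"] k by auto
  show "k \<in> left_descents n (simple_refl k \<circ> w)"
    using lt k by (simp add: left_descents_def inv_transpose_comp[OF w])
qed

text \<open>Left multiplication alters only the comparison of \<open>k\<close> with
  \<open>k + 1\<close>. An entry at a position in between is below \<open>w i\<close> or above
  \<open>w j\<close>; if it were \<open>k + 1\<close> with \<open>w j = k\<close>, it would fall
  inside the second cover.\<close>

lemma exceed_between_simple_refl:
  assumes w: "w permutes {1..n}" and e: "(i, j) \<in> covers n w" "(i, j) \<in> covers n (simple_refl k \<circ> w)"
  shows "exceed_between (simple_refl k \<circ> w) i j = exceed_between w i j"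
proof -
  have "(simple_refl k \<circ> w) j < (simple_refl k \<circ> w) m \<longleftrightarrow> w j < w m" if m: "i < m" "m < j" for m
  proof -
    have inj: "w a = w b \<longleftrightarrow> a = b" for a b using permutes_inj[OF w] by (simp add: inj_eq)
    have lt: "w i < w j" and "\<not> (w i < w m \<and> w m < w j)" "w m \<noteq> w i" "w m \<noteq> w j"
      using e(1) m by (auto simp: covers_def inj)
    then consider "w m < w i" | "w j < w m" by linarith
    then show ?thesis
    proof cases
      case 1
      then have "\<not> (w m = k \<and> w j = k + 1)" "w m < w j" using lt by auto
      then show ?thesis by (auto simp: transpose_def)
    next
      case 2
      have "\<not> (w j = k \<and> w m = k + 1)"
      proof
        assume "w j = k \<and> w m = k + 1"
        then have "(simple_refl k \<circ> w) i < (simple_refl k \<circ> w) m" "(simple_refl k \<circ> w) m < (simple_refl k \<circ> w) j"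
          using lt by (auto simp: transpose_def)
        then show False using e(2) m by (auto simp: covers_def)
      qed
      then show ?thesis using 2 by (auto simp: transpose_def)
    qed
  qed
  then show ?thesis by (auto simp: exceed_between_def intro!: arg_cong[of _ _ card])
qed

text \<open>Off the diagonal, going up and then down matches going down and then up. The lengths
  decide this once the descents are known, and \<open>cover_lifting\<close> confines the exceptional
  descents to the diagonal.\<close>

lemma cover_commute:
  assumes w: "w permutes {1..n}" and ne: "simple_refl k \<circ> (w \<circ> transpose i j) \<noteq> w"
  shows "(i, j) \<in> covers n w \<and> k \<in> left_descents n (w \<circ> transpose i j) \<longleftrightarrow>
    k \<in> left_descents n w \<and> (i, j) \<in> covers n (simple_refl k \<circ> w)"
proof
  assume *: "(i, j) \<in> covers n w \<and> k \<in> left_descents n (w \<circ> transpose i j)"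
  then have ij: "1 \<le> i" "i < j" "j \<le> n" and k: "1 \<le> k" "k < n"
    by (auto simp: covers_def left_descents_def)
  have wt: "w \<circ> transpose i j permutes {1..n}" and sw: "simple_refl k \<circ> w permutes {1..n}"
    using permutes_comp_transpose[OF w] ij k by auto
  have d: "k \<in> left_descents n w"
  proof (rule ccontr)
    assume "k \<notin> left_descents n w"
    from cover_lifting[OF w _ this, of i j] * have "i = inv w k" "j = inv w (k + 1)" by blast+
    then have "w \<circ> transpose i j = simple_refl k \<circ> w" using simple_refl_comp_eq[OF w] by simp
    then show False using ne by (simp add: comp_assoc[symmetric])
  qed
  have "inversions n (simple_refl k \<circ> w \<circ> transpose i j) = inversions n (simple_refl k \<circ> w) + 1"
    using inversions_left_descent[OF w d] inversions_left_descent[OF wt, of k] * covers_iff[OF w ij]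
    by (simp add: comp_assoc)
  then show "k \<in> left_descents n w \<and> (i, j) \<in> covers n (simple_refl k \<circ> w)"
    using d covers_iff[OF sw ij] by simp
next
  assume *: "k \<in> left_descents n w \<and> (i, j) \<in> covers n (simple_refl k \<circ> w)"
  then have ij: "1 \<le> i" "i < j" "j \<le> n" and k: "1 \<le> k" "k < n"
    by (auto simp: covers_def left_descents_def)
  let ?u = "simple_refl k \<circ> w"
  have wt: "w \<circ> transpose i j permutes {1..n}" and u: "?u permutes {1..n}"
    using permutes_comp_transpose[OF w] ij k by auto
  have ut: "?u \<circ> transpose i j permutes {1..n}"
    using permutes_comp_transpose[OF u] ij by auto
  have su: "simple_refl k \<circ> ?u = w" by (simp add: comp_assoc[symmetric])
  have L: "inversions n w = inversions n ?u + 1" using inversions_left_descent[OF w] * by blast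
  then have ku: "k \<notin> left_descents n ?u" using left_descents_iff[OF u k] su by simp
  have kut: "k \<notin> left_descents n (?u \<circ> transpose i j)"
  proof
    assume "k \<in> left_descents n (?u \<circ> transpose i j)"
    from cover_lifting[OF u _ ku this] * have "i = inv ?u k" "j = inv ?u (k + 1)" by blast+
    then have "?u \<circ> transpose i j = simple_refl k \<circ> ?u" using simple_refl_comp_eq[OF u] by simp
    then show False using ne su by (simp add: comp_assoc)
  qed
  have s: "simple_refl k \<circ> (?u \<circ> transpose i j) = w \<circ> transpose i j"
    using su by (metis comp_assoc)
  have Lut: "inversions n (?u \<circ> transpose i j) = inversions n ?u + 1" using covers_iff[OF u ij] * by simp
  have Lwt: "inversions n (w \<circ> transpose i j) = inversions n (?u \<circ> transpose i j) + 1"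
    using inversions_not_left_descent[OF ut kut k] unfolding s .
  then have "(i, j) \<in> covers n w" using covers_iff[OF w ij] L Lut by simp
  moreover have "k \<in> left_descents n (w \<circ> transpose i j)"
    using left_descents_iff[OF wt k] Lwt by (simp add: comp_assoc)
  ultimately show "(i, j) \<in> covers n w \<and> k \<in> left_descents n (w \<circ> transpose i j)" by simp
qed

section \<open>The Lehmer code and the diagonal of the commutator\<close>

definition left_code :: "nat \<Rightarrow> (nat \<Rightarrow> nat) \<Rightarrow> nat \<Rightarrow> nat" where
  "left_code n p k = card {v. k < v \<and> v \<le> n \<and> p v < p k}"

lemma sum_left_code: "(\<Sum>k = 1..n. left_code n p k) = inversions n p"
proof -
  have "{(a, b). 1 \<le> a \<and> a < b \<and> b \<le> n \<and> p b < p a} = (SIGMA k:{1..n}. {v. k < v \<and> v \<le> n \<and> p v < p k})"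
    by auto
  moreover have "finite {v. k < v \<and> v \<le> n \<and> p v < p k}" for k
    by (rule finite_subset[of _ "{..n}"]) auto
  ultimately show ?thesis by (simp add: inversions_def left_code_def)
qed

text \<open>Abel summation with the boundary term at \<open>n\<close>.\<close>

lemma sum_weighted_differences:
  fixes d :: "nat \<Rightarrow> int"
  shows "(\<Sum>k\<in>{1..<n}. int k * (d (k + 1) - d k)) = int n * d n - (\<Sum>k = 1..n. d k)"
proof (induction n)
  case (Suc n)
  then show ?case by (cases "n = 0") (simp_all add: algebra_simps)
qed simp

text \<open>The indices \<open>v > k + 1\<close> are sorted by comparing \<open>p v\<close> with
  \<open>p k\<close> and \<open>p (k + 1)\<close>. At a descent the index \<open>k + 1\<close>
  itself is counted by the code at \<open>k\<close>, hence the additional \<open>1\<close>.\<close>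

lemma left_code_differences:
  assumes p: "p permutes {1..n}" and k: "1 \<le> k" "k < n"
  shows "p k < p (k + 1) \<Longrightarrow>
      left_code n p (k + 1) = left_code n p k + card {v. k + 1 < v \<and> v \<le> n \<and> p k < p v \<and> p v < p (k + 1)}"
    and "p (k + 1) < p k \<Longrightarrow>
      left_code n p k = left_code n p (k + 1) + 1 + card {v. k + 1 < v \<and> v \<le> n \<and> p (k + 1) < p v \<and> p v < p k}"
proof -
  have fin: "finite {v. k + 1 < v \<and> v \<le> n \<and> P v}" for P
    by (rule finite_subset[of _ "{..n}"]) auto
  have ne: "p v \<noteq> p k" "p v \<noteq> p (k + 1)" if "k + 1 < v" for v
    using that permutes_inj[OF p] by (auto simp: inj_eq)
  have split: "card {v. k + 1 < v \<and> v \<le> n \<and> p v < b} =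
      card {v. k + 1 < v \<and> v \<le> n \<and> p v < a} + card {v. k + 1 < v \<and> v \<le> n \<and> a < p v \<and> p v < b}"
    if "a < b" "\<And>v. k + 1 < v \<Longrightarrow> p v \<noteq> a" for a b
    using that by (subst card_Un_disjoint[symmetric, OF fin fin]) (force intro!: arg_cong[of _ _ card])+
  { assume lt: "p k < p (k + 1)"
    have "{v. k < v \<and> v \<le> n \<and> p v < p k} = {v. k + 1 < v \<and> v \<le> n \<and> p v < p k}"
      using lt by (auto simp: Suc_lessI) (metis Suc_lessI not_less_iff_gr_or_eq)
    then show "left_code n p (k + 1) = left_code n p k + card {v. k + 1 < v \<and> v \<le> n \<and> p k < p v \<and> p v < p (k + 1)}"
      using split[OF lt] ne by (simp add: left_code_def) }
  { assume lt: "p (k + 1) < p k"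
    have "{v. k < v \<and> v \<le> n \<and> p v < p k} = insert (k + 1) {v. k + 1 < v \<and> v \<le> n \<and> p v < p k}"
      using lt k by auto
    then show "left_code n p k = left_code n p (k + 1) + 1 + card {v. k + 1 < v \<and> v \<le> n \<and> p (k + 1) < p v \<and> p v < p k}"
      using split[OF lt] ne fin[of "\<lambda>v. p v < p k"] by (simp add: left_code_def) }
qed

text \<open>\<open>w\<close> carries positions to values; this brings \<open>exceed_between\<close>
  into the form of \<open>left_code_differences\<close>.\<close>

lemma card_positions_values:
  fixes n i j c :: nat
  assumes w: "w permutes {1..n}" and "1 \<le> i" "j \<le> n"
  shows "card {m. i < m \<and> m < j \<and> c < w m} = card {v. c < v \<and> v \<le> n \<and> i < inv w v \<and> inv w v < j}"
proof (rule bij_betw_same_card)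
  have I: "inv w (w a) = a" "w (inv w a) = a" for a using permutes_inverses[OF w] by auto
  have "w m \<le> n" if "i < m" "m < j" for m
  proof -
    have "m \<in> {1..n}" using that assms by auto
    then show ?thesis using permutes_in_image[OF w, of m] by auto
  qed
  then show "bij_betw w {m. i < m \<and> m < j \<and> c < w m} {v. c < v \<and> v \<le> n \<and> i < inv w v \<and> inv w v < j}"
    by (intro bij_betw_byWitness[where f' = "inv w"]) (auto simp: I)
qed

text \<open>The diagonal coefficients of the commutator of the lowering operator of the left weak order
  and the raising operator of the strong order.\<close>

lemma commutator_diagonal:
  assumes w: "w permutes {1..n}"
  shows "(\<Sum>k\<in>{1..<n} - left_descents n w. int k * (1 + 2 * int (exceed_between w (inv w k) (inv w (k + 1))))) -
    (\<Sum>k\<in>left_descents n w. int k * (1 + 2 * int (exceed_between (simple_refl k \<circ> w) (inv w (k + 1)) (inv w k)))) =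
    int (n choose 2) - 2 * int (inversions n w)"
proof -
  define p where "p = inv w"
  have p: "p permutes {1..n}" using permutes_inv[OF w] by (simp add: p_def)
  have wp: "w (p a) = a" "p (w a) = a" for a using permutes_inverses[OF w] by (simp_all add: p_def)
  have pin: "p a \<in> {1..n} \<longleftrightarrow> a \<in> {1..n}" for a using permutes_in_image[OF p] .
  define d where "d = (\<lambda>k. int (left_code n p k))"
  have asc: "1 + 2 * int (exceed_between w (p k) (p (k + 1))) = 1 + 2 * (d (k + 1) - d k)"
    if k: "k \<in> {1..<n} - left_descents n w" for k
  proof -
    have lt: "p k < p (k + 1)" using k permutes_lt_or_gt[OF p, of k "k + 1"] by (auto simp: left_descents_def p_def)
    have "exceed_between w (p k) (p (k + 1)) = card {v. k + 1 < v \<and> v \<le> n \<and> p k < p v \<and> p v < p (k + 1)}"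
      unfolding exceed_between_def wp
      using card_positions_values[OF w, of "p k" "p (k + 1)" "k + 1"] pin[of k] pin[of "k + 1"] k
      by (simp add: p_def)
    then show ?thesis using left_code_differences(1)[OF p _ _ lt] k by (simp add: d_def)
  qed
  \<comment> \<open>The additional \<open>1\<close> at descents makes this the exact negative of the
    ascent formula, so both sums merge into one over \<open>{1..<n}\<close>.\<close>
  have desc: "1 + 2 * int (exceed_between (simple_refl k \<circ> w) (p (k + 1)) (p k)) = - (1 + 2 * (d (k + 1) - d k))"
    if k: "k \<in> left_descents n w" for k
  proof -
    have lt: "p (k + 1) < p k" and k1: "1 \<le> k" "k < n" using k by (auto simp: left_descents_def p_def)
    have "(simple_refl k \<circ> w) (p k) < (simple_refl k \<circ> w) m \<longleftrightarrow> k + 1 < w m"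
      if "p (k + 1) < m" "m < p k" for m
    proof -
      have "w m \<noteq> k" "w m \<noteq> k + 1" using that wp(2)[of m] by auto
      then show ?thesis by (simp add: wp transpose_def)
    qed
    then have "exceed_between (simple_refl k \<circ> w) (p (k + 1)) (p k) = card {m. p (k + 1) < m \<and> m < p k \<and> k + 1 < w m}"
      unfolding exceed_between_def by (intro arg_cong[of _ _ card]) auto
    also have "\<dots> = card {v. k + 1 < v \<and> v \<le> n \<and> p (k + 1) < p v \<and> p v < p k}"
      using card_positions_values[OF w, of "p (k + 1)" "p k" "k + 1"] pin[of k] pin[of "k + 1"] k1
      by (simp add: p_def)
    finally show ?thesis using left_code_differences(2)[OF p k1 lt] by (simp add: d_def)
  qed
  have "(\<Sum>k\<in>{1..<n} - left_descents n w. int k * (1 + 2 * int (exceed_between w (p k) (p (k + 1))))) -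
      (\<Sum>k\<in>left_descents n w. int k * (1 + 2 * int (exceed_between (simple_refl k \<circ> w) (p (k + 1)) (p k)))) =
      (\<Sum>k\<in>{1..<n} - left_descents n w. int k * (1 + 2 * (d (k + 1) - d k))) +
      (\<Sum>k\<in>left_descents n w. int k * (1 + 2 * (d (k + 1) - d k)))"
    by (simp only: asc desc mult_minus_right sum_negf diff_minus_eq_add cong: sum.cong)
  also have "\<dots> = (\<Sum>k\<in>{1..<n}. int k * (1 + 2 * (d (k + 1) - d k)))"
    by (rule sum.subset_diff[symmetric]) (auto simp: left_descents_def)
  also have "\<dots> = (\<Sum>k\<in>{1..<n}. int k) + 2 * (\<Sum>k\<in>{1..<n}. int k * (d (k + 1) - d k))"
    by (simp add: distrib_left sum.distrib sum_distrib_left mult_ac)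
  also have "(\<Sum>k\<in>{1..<n}. int k) = int (n choose 2)"
  proof -
    have "(\<Sum>k\<in>{1..<n}. int k) = int (\<Sum>i = 1..n. n - i)"
      unfolding of_nat_sum
      by (rule sum.reindex_bij_witness_not_neutral[of "{}" "{n}" _ "\<lambda>i. n - i" "\<lambda>i. n - i"]) auto
    then show ?thesis by (simp only: sum_diff_eq_choose)
  qed
  also have "(\<Sum>k\<in>{1..<n}. int k * (d (k + 1) - d k)) = - int (inversions n w)"
  proof -
    \<comment> \<open>No index beyond \<open>n\<close> is counted, so the boundary term of the Abel
      summation vanishes.\<close>
    have "d n = 0" by (auto simp: d_def left_code_def card_eq_0_iff)
    moreover have "(\<Sum>k = 1..n. d k) = int (inversions n w)"
      unfolding d_def of_nat_sum[symmetric] sum_left_code p_def inversions_inv[OF w] ..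
    ultimately show ?thesis unfolding sum_weighted_differences by simp
  qed
  finally show ?thesis unfolding p_def mult_minus_right add_uminus_conv_diff .
qed

section \<open>Cover sums for the weights \<open>1 + 2 b\<close> and \<open>1 + 2 c\<close>\<close>

lemma sum_covers_exceed_between:
  assumes "w permutes {1..n}"
  shows "(\<Sum>(i, j)\<in>covers n w. (1 + 2 * int (exceed_between w i j)) * schubert_one n (w \<circ> transpose i j)) =
    (int (n choose 2) - int (inversions n w)) * schubert_one n w"
  using assms
proof (induction "inversions n w" arbitrary: w rule: less_induct)
  case less
  note w = less.prems
  let ?N = "int (n choose 2)" and ?L = "int (inversions n w)"
  \<comment> \<open>\<open>A\<close> indexes the ways to go up by a cover and then down by a left
    descent, \<open>B\<close> the ways to go down first. \<open>X\<close> is the diagonal, where the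
    path returns to \<open>w\<close>.\<close>
  define A where "A = (SIGMA e:covers n w. left_descents n (w \<circ> transpose (fst e) (snd e)))"
  define B where "B = {(e, k). k \<in> left_descents n w \<and> e \<in> covers n (simple_refl k \<circ> w)}"
  define X where "X = {(e, k). simple_refl k \<circ> (w \<circ> transpose (fst e) (snd e)) = w}"
  define F where "F = (\<lambda>u (e, k). int k * (1 + 2 * int (exceed_between u (fst e) (snd e))) *
    schubert_one n (simple_refl k \<circ> (w \<circ> transpose (fst e) (snd e))))"
  have Bi: "B = (\<lambda>(k, e). (e, k)) ` (SIGMA k:left_descents n w. covers n (simple_refl k \<circ> w))"
    by (force simp: B_def)
  have fA: "finite A" and fB: "finite B" by (auto simp: A_def Bi)
  have L1: "inversions n (w \<circ> transpose i j) = inversions n w + 1" "w \<circ> transpose i j permutes {1..n}"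
    if "(i, j) \<in> covers n w" for i j
    using that covers_iff[OF w, of i j] permutes_comp_transpose(1)[OF w, of i j] by (auto simp: covers_def)
  have sw: "simple_refl k \<circ> w permutes {1..n}" if "k \<in> left_descents n w" for k
    using permutes_comp_transpose(2)[OF w] that by (auto simp: left_descents_def)
  \<comment> \<open>Every cover of \<open>w\<close> has length \<open>?L + 1\<close>, so this factor
    is traded for a sum over the left descents of the cover.\<close>
  have "(?L + 1) * (\<Sum>(i, j)\<in>covers n w. (1 + 2 * int (exceed_between w i j)) * schubert_one n (w \<circ> transpose i j)) =
      (\<Sum>e\<in>covers n w. \<Sum>k\<in>left_descents n (w \<circ> transpose (fst e) (snd e)). F w (e, k))"
    unfolding sum_distrib_left
  proof (rule sum.cong, rule refl, clarify)
    fix i j assume e: "(i, j) \<in> covers n w"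
    have "(?L + 1) * ((1 + 2 * int (exceed_between w i j)) * schubert_one n (w \<circ> transpose i j)) =
      (1 + 2 * int (exceed_between w i j)) * (int (inversions n (w \<circ> transpose i j)) * schubert_one n (w \<circ> transpose i j))"
      by (simp add: L1[OF e])
    also have "\<dots> = (\<Sum>k\<in>left_descents n (w \<circ> transpose i j). F w ((i, j), k))"
      unfolding schubert_one_left_descents[OF L1(2)[OF e]] sum_distrib_left F_def
      by (rule sum.cong) (simp_all add: mult_ac)
    finally show "(?L + 1) * ((1 + 2 * int (exceed_between w i j)) * schubert_one n (w \<circ> transpose i j)) =
      (\<Sum>k\<in>left_descents n (w \<circ> transpose (fst (i, j)) (snd (i, j))). F w ((i, j), k))" by simp
  qed
  also have "\<dots> = sum (F w) A"
    unfolding A_def by (subst sum.Sigma) (simp_all add: split_def)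
  also have "\<dots> = sum (F w) (A - X) + sum (F w) (A \<inter> X)"
    using sum.Int_Diff[OF fA, of "F w" X] by simp
  finally have up: "(?L + 1) * (\<Sum>(i, j)\<in>covers n w. (1 + 2 * int (exceed_between w i j)) * schubert_one n (w \<circ> transpose i j)) =
      sum (F w) (A - X) + sum (F w) (A \<inter> X)" .
  let ?G = "\<lambda>p. F (simple_refl (snd p) \<circ> w) p"
  \<comment> \<open>The factor \<open>?N - ?L + 1\<close> is the one in the induction hypothesis at
    \<open>simple_refl k \<circ> w\<close>, which is shorter by one.\<close>
  have "(?N - ?L + 1) * (?L * schubert_one n w) =
      (\<Sum>k\<in>left_descents n w. int k * ((?N - ?L + 1) * schubert_one n (simple_refl k \<circ> w)))"
    unfolding schubert_one_left_descents[OF w] sum_distrib_left by (simp add: mult_ac)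
  also have "\<dots> = (\<Sum>k\<in>left_descents n w. \<Sum>e\<in>covers n (simple_refl k \<circ> w). ?G (e, k))"
  proof (rule sum.cong, rule refl)
    fix k assume k: "k \<in> left_descents n w"
    have L: "inversions n w = inversions n (simple_refl k \<circ> w) + 1" using inversions_left_descent[OF w k] .
    have "(?N - ?L + 1) * schubert_one n (simple_refl k \<circ> w) =
        (\<Sum>(i, j)\<in>covers n (simple_refl k \<circ> w). (1 + 2 * int (exceed_between (simple_refl k \<circ> w) i j)) *
          schubert_one n (simple_refl k \<circ> w \<circ> transpose i j))"
      by (subst less.hyps[OF _ sw[OF k]]) (use L in simp_all)
    then show "int k * ((?N - ?L + 1) * schubert_one n (simple_refl k \<circ> w)) =
        (\<Sum>e\<in>covers n (simple_refl k \<circ> w). ?G (e, k))"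
      unfolding F_def by (simp add: sum_distrib_left split_def mult_ac comp_assoc)
  qed
  also have "\<dots> = sum ?G B"
    unfolding Bi by (subst sum.reindex) (auto simp: inj_on_def sum.Sigma split_def)
  also have "\<dots> = sum ?G (B - X) + sum ?G (B \<inter> X)"
    using sum.Int_Diff[OF fB, of ?G X] by simp
  finally have down: "(?N - ?L + 1) * (?L * schubert_one n w) = sum ?G (B - X) + sum ?G (B \<inter> X)" .
  \<comment> \<open>Off the diagonal the index sets agree by \<open>cover_commute\<close>; the
    summands then agree by \<open>exceed_between_simple_refl\<close>.\<close>
  have AB: "A - X = B - X"
  proof (rule set_eqI)
    fix p :: "(nat \<times> nat) \<times> nat"
    obtain i j k where p: "p = ((i, j), k)" by (metis surj_pair)
    show "p \<in> A - X \<longleftrightarrow> p \<in> B - X"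
      using cover_commute[OF w, of k i j] unfolding p A_def B_def X_def by auto
  qed
  have off: "sum (F w) (A - X) = sum ?G (B - X)"
    unfolding AB
  proof (rule sum.cong, rule refl)
    fix p assume p: "p \<in> B - X"
    then obtain i j k where e: "p = ((i, j), k)" "(i, j) \<in> covers n (simple_refl k \<circ> w)"
      by (auto simp: B_def)
    have "p \<in> A - X" using p AB by simp
    then have "(i, j) \<in> covers n w" by (auto simp: A_def e)
    from exceed_between_simple_refl[OF w this e(2)] show "F w p = ?G p" by (simp add: F_def e)
  qed
  \<comment> \<open>By the lifting property, the paths going up and returning to \<open>w\<close>
    correspond to the left ascents.\<close>
  have AX: "A \<inter> X = (\<lambda>k. ((inv w k, inv w (k + 1)), k)) ` ({1..<n} - left_descents n w)"
  proof (intro equalityI subsetI)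
    fix p assume p: "p \<in> A \<inter> X"
    then obtain i j k where e: "p = ((i, j), k)" and c: "(i, j) \<in> covers n w"
      and k: "k \<in> left_descents n (w \<circ> transpose i j)" and x: "simple_refl k \<circ> (w \<circ> transpose i j) = w"
      by (auto simp: A_def X_def)
    have wt: "w \<circ> transpose i j = simple_refl k \<circ> w"
      using x by (metis comp_assoc id_comp transpose_comp_involutory)
    have kn: "1 \<le> k" "k < n" using k by (auto simp: left_descents_def)
    have nk: "k \<notin> left_descents n w" using left_descents_iff[OF w kn] L1[OF c] wt by simp
    from cover_lifting[OF w c nk k] nk kn show "p \<in> (\<lambda>k. ((inv w k, inv w (k + 1)), k)) ` ({1..<n} - left_descents n w)"
      by (auto simp: e)
  next
    fix p assume "p \<in> (\<lambda>k. ((inv w k, inv w (k + 1)), k)) ` ({1..<n} - left_descents n w)"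
    then obtain k where e: "p = ((inv w k, inv w (k + 1)), k)" and kn: "1 \<le> k" "k < n"
      and k: "k \<notin> left_descents n w" by auto
    have "simple_refl k \<circ> (w \<circ> transpose (inv w k) (inv w (k + 1))) = w"
      unfolding simple_refl_comp_eq[OF w, symmetric] by (simp add: comp_assoc[symmetric])
    then show "p \<in> A \<inter> X"
      using cover_left_ascent[OF w kn k] simple_refl_comp_eq[OF w, of k] by (simp add: A_def X_def e)
  qed
  have BX: "B \<inter> X = (\<lambda>k. ((inv w (k + 1), inv w k), k)) ` left_descents n w"
  proof -
    have iff: "(k \<in> left_descents n w \<and> (i, j) \<in> covers n (simple_refl k \<circ> w) \<and>
        simple_refl k \<circ> (w \<circ> transpose i j) = w) \<longleftrightarrow>
        k \<in> left_descents n w \<and> i = inv w (k + 1) \<and> j = inv w k" for i j k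
    proof (cases "k \<in> left_descents n w")
      case True
      let ?u = "simple_refl k \<circ> w"
      note u = sw[OF True]
      have kn: "1 \<le> k" "k < n" using True by (auto simp: left_descents_def)
      have su: "simple_refl k \<circ> ?u = w" by (simp add: comp_assoc[symmetric])
      have ku: "k \<notin> left_descents n ?u"
        using left_descents_iff[OF u kn] inversions_left_descent[OF w True] su by simp
      have iu: "inv ?u k = inv w (k + 1)" "inv ?u (k + 1) = inv w k" by (simp_all add: inv_transpose_comp[OF w])
      show ?thesis
      proof
        assume *: "k \<in> left_descents n w \<and> (i, j) \<in> covers n ?u \<and> simple_refl k \<circ> (w \<circ> transpose i j) = w"
        then have "k \<in> left_descents n (?u \<circ> transpose i j)" by (simp add: comp_assoc)
        from cover_lifting[OF u _ ku this] * show "k \<in> left_descents n w \<and> i = inv w (k + 1) \<and> j = inv w k"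
          unfolding iu by blast
      next
        assume *: "k \<in> left_descents n w \<and> i = inv w (k + 1) \<and> j = inv w k"
        have "(i, j) \<in> covers n ?u" using cover_left_ascent(1)[OF u kn ku] * unfolding iu by simp
        moreover have "?u \<circ> transpose i j = w"
          using simple_refl_comp_eq[OF u, of k] su * unfolding iu by simp
        ultimately show "k \<in> left_descents n w \<and> (i, j) \<in> covers n ?u \<and> simple_refl k \<circ> (w \<circ> transpose i j) = w"
          using True by (simp add: comp_assoc)
      qed
    qed simp
    show ?thesis
    proof (rule set_eqI)
      fix p :: "(nat \<times> nat) \<times> nat"
      obtain i j k where p: "p = ((i, j), k)" by (metis surj_pair)
      show "p \<in> B \<inter> X \<longleftrightarrow> p \<in> (\<lambda>k. ((inv w (k + 1), inv w k), k)) ` left_descents n w"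
        using iff[of k i j] unfolding p B_def X_def by (auto simp: image_iff)
    qed
  qed
  have "sum (F w) (A \<inter> X) = (\<Sum>p\<in>A \<inter> X. int (snd p) * (1 + 2 * int (exceed_between w (fst (fst p)) (snd (fst p))))) * schubert_one n w"
    unfolding sum_distrib_right by (rule sum.cong) (auto simp: F_def X_def)
  also have "\<dots> = (\<Sum>k\<in>{1..<n} - left_descents n w. int k * (1 + 2 * int (exceed_between w (inv w k) (inv w (k + 1))))) * schubert_one n w"
    unfolding AX by (subst sum.reindex) (auto simp: inj_on_def)
  finally have SA: "sum (F w) (A \<inter> X) = \<dots>" .
  have "sum ?G (B \<inter> X) = (\<Sum>p\<in>B \<inter> X. int (snd p) * (1 + 2 * int (exceed_between (simple_refl (snd p) \<circ> w) (fst (fst p)) (snd (fst p))))) * schubert_one n w"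
    unfolding sum_distrib_right by (rule sum.cong) (auto simp: F_def X_def)
  also have "\<dots> = (\<Sum>k\<in>left_descents n w. int k * (1 + 2 * int (exceed_between (simple_refl k \<circ> w) (inv w (k + 1)) (inv w k)))) * schubert_one n w"
    unfolding BX by (subst sum.reindex) (auto simp: inj_on_def)
  finally have SB: "sum ?G (B \<inter> X) = \<dots>" .
  have diag: "sum (F w) (A \<inter> X) - sum ?G (B \<inter> X) = (?N - 2 * ?L) * schubert_one n w"
    unfolding SA SB left_diff_distrib[symmetric] commutator_diagonal[OF w] ..
  \<comment> \<open>The diagonal adds to the induction hypothesis as
    \<open>(N - L + 1) * L + (N - 2 * L) = (L + 1) * (N - L)\<close>.\<close>
  have "(?L + 1) * (\<Sum>(i, j)\<in>covers n w. (1 + 2 * int (exceed_between w i j)) * schubert_one n (w \<circ> transpose i j)) =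
      (?N - ?L + 1) * (?L * schubert_one n w) + (?N - 2 * ?L) * schubert_one n w"
    using up down off diag by linarith
  also have "\<dots> = (?L + 1) * ((?N - ?L) * schubert_one n w)" by (simp add: algebra_simps)
  finally have "?L + 1 = 0 \<or> (\<Sum>(i, j)\<in>covers n w. (1 + 2 * int (exceed_between w i j)) * schubert_one n (w \<circ> transpose i j)) =
      (?N - ?L) * schubert_one n w"
    by (simp only: mult_cancel_left)
  then show ?case by linarith
qed

text \<open>Passing to inverses turns the cover at \<open>(i, j)\<close> into one at
  \<open>(w i, w j)\<close> and exchanges the two statistics, while \<open>schubert_one\<close> is
  invariant.\<close>

lemma sum_covers_between_after:
  assumes w: "w permutes {1..n}"
  shows "(\<Sum>(i, j)\<in>covers n w. (1 + 2 * int (between_after n w i j)) * schubert_one n (w \<circ> transpose i j)) =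
    (int (n choose 2) - int (inversions n w)) * schubert_one n w"
proof -
  have I: "inv w (w a) = a" "w (inv w a) = a" for a using permutes_inverses[OF w] by auto
  have ii: "inv (inv w) = w" using permutes_inv_inv[OF w] .
  have cov: "(u i, u j) \<in> covers n (inv u)" if u: "u permutes {1..n}" and e: "(i, j) \<in> covers n u" for u i j
  proof -
    have J: "inv u (u a) = a" "u (inv u a) = a" for a using permutes_inverses[OF u] by auto
    have ij: "i \<in> {1..n}" "j \<in> {1..n}" "i < j" "u i < u j" and no: "\<And>m. i < m \<Longrightarrow> m < j \<Longrightarrow> u i < u m \<Longrightarrow> \<not> u m < u j"
      using e by (auto simp: covers_def)
    have "u i \<in> {1..n}" "u j \<in> {1..n}" using ij permutes_in_image[OF u] by blast+
    moreover have "\<not> (inv u (u i) < inv u m \<and> inv u m < inv u (u j))" if "u i < m" "m < u j" for m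
      using no[of "inv u m"] that by (auto simp: J)
    ultimately show ?thesis using ij by (auto simp: covers_def J)
  qed
  have "(\<Sum>(i, j)\<in>covers n w. (1 + 2 * int (between_after n w i j)) * schubert_one n (w \<circ> transpose i j)) =
    (\<Sum>(i, j)\<in>covers n (inv w). (1 + 2 * int (exceed_between (inv w) i j)) * schubert_one n (inv w \<circ> transpose i j))"
  proof (rule sum.reindex_bij_witness[of _ "map_prod (inv w) (inv w)" "map_prod w w"])
    fix p
    show "map_prod (inv w) (inv w) (map_prod w w p) = p" "map_prod w w (map_prod (inv w) (inv w) p) = p"
      by (cases p, simp add: I)+
    show "map_prod w w p \<in> covers n (inv w)" if "p \<in> covers n w"
      using that cov[OF w] by (cases p) simp
    show "map_prod (inv w) (inv w) p \<in> covers n w" if "p \<in> covers n (inv w)"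
      using that cov[OF permutes_inv[OF w]] unfolding ii by (cases p) simp
    assume "p \<in> covers n w"
    then obtain i j where p: "p = (i, j)" and e: "(i, j) \<in> covers n w" by (cases p) auto
    have ij: "1 \<le> i" "i \<le> n" "1 \<le> j" "j \<le> n" using e by (auto simp: covers_def)
    have "bij_betw w {k. j < k \<and> k \<le> n \<and> w i < w k \<and> w k < w j} {k. w i < k \<and> k < w j \<and> inv w (w j) < inv w k}"
    proof (rule bij_betw_byWitness[where f' = "inv w"])
      \<comment> \<open>A position beyond \<open>n\<close> is fixed and so carries a value above
        \<open>n\<close>, whereas \<open>w j\<close> is at most \<open>n\<close>.\<close>
      have "inv w k \<le> n" if "k < w j" for k
      proof (rule ccontr)
        assume a: "\<not> inv w k \<le> n"
        then have "inv w k \<notin> {1..n}" by simp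
        then have "k \<notin> {1..n}" using permutes_in_image[OF permutes_inv[OF w], of k] by blast
        then have "inv w k = k" using permutes_not_in[OF permutes_inv[OF w]] by blast
        moreover have "w j \<in> {1..n}" using permutes_in_image[OF w, of j] ij by simp
        ultimately show False using a that by simp
      qed
      then show "inv w ` {k. w i < k \<and> k < w j \<and> inv w (w j) < inv w k} \<subseteq> {k. j < k \<and> k \<le> n \<and> w i < w k \<and> w k < w j}"
        by (auto simp: I)
    qed (auto simp: I)
    then have c: "exceed_between (inv w) (w i) (w j) = between_after n w i j"
      unfolding exceed_between_def between_after_def by (rule bij_betw_same_card[symmetric])
    have "inv (w \<circ> transpose i j) = inv w \<circ> transpose (w i) (w j)"
      unfolding inv_comp_transpose[OF w] using transpose_comp_eq[OF permutes_bij[OF permutes_inv[OF w]], of i j]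
      by (simp add: ii)
    moreover have "w \<circ> transpose i j permutes {1..n}" using permutes_comp_transpose(1)[OF w] ij by simp
    ultimately have "schubert_one n (inv w \<circ> transpose (w i) (w j)) = schubert_one n (w \<circ> transpose i j)"
      using schubert_one_inv by metis
    then show "(case map_prod w w p of (i, j) \<Rightarrow>
          (1 + 2 * int (exceed_between (inv w) i j)) * schubert_one n (inv w \<circ> transpose i j)) =
        (case p of (i, j) \<Rightarrow>
          (1 + 2 * int (between_after n w i j)) * schubert_one n (w \<circ> transpose i j))"
      by (simp add: p c)
  qed
  then show ?thesis
    using sum_covers_exceed_between[OF permutes_inv[OF w]] by (simp add: inversions_inv[OF w] schubert_one_inv[OF w])
qed

section \<open>Saturated chains\<close>

lemma transpose_eq_iff_ordered:
  fixes i j i' j' :: nat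
  assumes "i < j" "i' < j'"
  shows "transpose i j = transpose i' j' \<longleftrightarrow> i = i' \<and> j = j'"
proof
  assume e: "transpose i j = transpose i' j'"
  from fun_cong[OF this, of i] fun_cong[OF this, of j] assms show "i = i' \<and> j = j'"
    by (auto simp: transpose_def split: if_splits)
qed simp

lemma comp_transpose_eq_iff:
  fixes i j i' j' :: nat
  assumes "inj w" "i < j" "i' < j'"
  shows "w \<circ> transpose i j = w \<circ> transpose i' j' \<longleftrightarrow> i = i' \<and> j = j'"
  using transpose_eq_iff_ordered[OF assms(2,3)] assms(1) by (metis fun.inj_map_strong injD)

text \<open>Different transpositions applied to \<open>w\<close> give different permutations, so the
  description in \<open>cover_positions\<close> has one solution.\<close>

lemma cover_positions_eq:
  assumes w: "w permutes {1..n}" and "i < j"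
  shows "cover_positions (w, w \<circ> transpose i j) = (i, j)"
  unfolding cover_positions_def
  by (rule the_equality)
    (use comp_transpose_eq_iff[OF permutes_inj[OF w]] assms in \<open>auto simp: split_def\<close>)

lemma bruhat_covers_Image:
  assumes w: "w permutes {1..n}"
  shows "bruhat_covers n `` {w} = (\<lambda>(i, j). w \<circ> transpose i j) ` covers n w"
proof -
  have "coxeter_length n (w \<circ> transpose i j) = coxeter_length n w + 1 \<longleftrightarrow> (i, j) \<in> covers n w"
    if ij: "1 \<le> i" "i < j" "j \<le> n" for i j
    using covers_iff[OF w ij] permutes_comp_transpose(1)[OF w, of i j] ij
    by (simp add: coxeter_length_eq_inversions[OF w] coxeter_length_eq_inversions)
  moreover have "1 \<le> i \<and> i < j \<and> j \<le> n" if "(i, j) \<in> covers n w" for i j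
    using that by (simp add: covers_def)
  ultimately show ?thesis using w unfolding bruhat_covers_def by (auto simp: image_iff) blast+
qed

lemma bruhat_covers_inversions:
  assumes "(v, w) \<in> bruhat_covers n"
  shows "inversions n w = inversions n v + 1"
  using assms bruhat_covers_permutes[OF assms] by (auto simp: bruhat_covers_def coxeter_length_eq_inversions)

text \<open>The doubled constant \<open>2\<close> is distributed as \<open>(2 - z) + z\<close>;
  doubling keeps the coefficients integral.\<close>

lemma bruhat_wt_transpose:
  assumes w: "w permutes {1..n}" and "i < j"
  shows "2 * bruhat_wt n (w, w \<circ> transpose i j) =
    [:2, - 1:] * of_int (1 + 2 * int (exceed_between w i j)) +
    [:0, 1:] * of_int (1 + 2 * int (between_after n w i j))"
proof -
  have z: "[:2, - 1:] = 2 - [:0, 1 :: int:]" by (simp add: numeral_poly)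
  show ?thesis
    unfolding bruhat_wt_def cover_b_def cover_c_def Let_def fst_conv cover_positions_eq[OF assms]
      prod.case exceed_between_def[symmetric] between_after_def[symmetric] z
    by (simp add: algebra_simps)
qed

lemma saturated_chains_longest: "saturated_chains n (longest_perm n) (longest_perm n) = {[longest_perm n]}"
proof (intro equalityI subsetI)
  fix us assume "us \<in> saturated_chains n (longest_perm n) (longest_perm n)"
  then have us: "us \<noteq> []" "hd us = longest_perm n" "successively (\<lambda>x y. (x, y) \<in> bruhat_covers n) us"
    by (auto simp: saturated_chains_def)
  have no: "(longest_perm n, x) \<notin> bruhat_covers n" for x
    using bruhat_covers_inversions[of "longest_perm n" x n] inversions_le[of n x]
    by (auto simp: inversions_longest)
  show "us \<in> {[longest_perm n]}"
  proof (cases us rule: remdups_adj.cases)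
    case (3 x y zs)
    then show ?thesis using us no by simp
  qed (use us in auto)
qed (simp add: saturated_chains_def)

lemma saturated_chains_step:
  assumes "w \<noteq> v"
  shows "saturated_chains n w v = (\<Union>u\<in>bruhat_covers n `` {w}. Cons w ` saturated_chains n u v)"
proof (intro equalityI subsetI)
  fix us assume us: "us \<in> saturated_chains n w v"
  show "us \<in> (\<Union>u\<in>bruhat_covers n `` {w}. Cons w ` saturated_chains n u v)"
  proof (cases us rule: remdups_adj.cases)
    case (3 x y zs)
    then have "us = w # (y # zs)" "(w, y) \<in> bruhat_covers n" "y # zs \<in> saturated_chains n y v"
      using us by (auto simp: saturated_chains_def)
    then show ?thesis by blast
  qed (use us assms in \<open>auto simp: saturated_chains_def\<close>)
next
  fix us assume "us \<in> (\<Union>u\<in>bruhat_covers n `` {w}. Cons w ` saturated_chains n u v)"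
  then show "us \<in> saturated_chains n w v"
    by (auto simp: saturated_chains_def successively_Cons)
qed

text \<open>Chains are sorted by their second element, and the covers are then indexed by their
  positions.\<close>

lemma chain_sum_step:
  assumes w: "w permutes {1..n}" and "w \<noteq> v"
  shows "chain_sum n wt w v =
    (\<Sum>(i, j)\<in>covers n w. wt (w, w \<circ> transpose i j) * chain_sum n wt (w \<circ> transpose i j) v)"
proof -
  have inj: "inj_on (\<lambda>(i, j). w \<circ> transpose i j) (covers n w)"
    using comp_transpose_eq_iff[OF permutes_inj[OF w]] by (auto simp: inj_on_def covers_def)
  have fin: "finite (saturated_chains n u v)" if "u \<in> bruhat_covers n `` {w}" for u
    using that bruhat_covers_permutes finite_saturated_chains by blast
  have hd: "hd us = u \<and> us \<noteq> []" if "us \<in> saturated_chains n u v" for us u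
    using that by (simp add: saturated_chains_def)
  have "chain_sum n wt w v = (\<Sum>u\<in>bruhat_covers n `` {w}. \<Sum>us\<in>Cons w ` saturated_chains n u v. chain_weight wt us)"
    unfolding chain_sum_def saturated_chains_step[OF assms(2)]
  proof (rule sum.UNION_disjoint)
    show "finite (bruhat_covers n `` {w})" unfolding bruhat_covers_Image[OF w] by simp
    show "\<forall>u\<in>bruhat_covers n `` {w}. finite (Cons w ` saturated_chains n u v)" using fin by blast
    show "\<forall>u\<in>bruhat_covers n `` {w}. \<forall>u'\<in>bruhat_covers n `` {w}. u \<noteq> u' \<longrightarrow>
        Cons w ` saturated_chains n u v \<inter> Cons w ` saturated_chains n u' v = {}"
      by (auto dest!: hd)
  qed
  also have "\<dots> = (\<Sum>u\<in>bruhat_covers n `` {w}. wt (w, u) * chain_sum n wt u v)"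
  proof (rule sum.cong, rule refl)
    fix u
    have "chain_weight wt (w # us) = wt (w, u) * chain_weight wt us" if "us \<in> saturated_chains n u v" for us
      using hd[OF that] by (cases us) (simp_all add: chain_weight_def)
    then show "(\<Sum>us\<in>Cons w ` saturated_chains n u v. chain_weight wt us) = wt (w, u) * chain_sum n wt u v"
      by (subst sum.reindex) (simp_all add: chain_sum_def sum_distrib_left)
  qed
  also have "\<dots> = (\<Sum>(i, j)\<in>covers n w. wt (w, w \<circ> transpose i j) * chain_sum n wt (w \<circ> transpose i j) v)"
    unfolding bruhat_covers_Image[OF w] by (subst sum.reindex[OF inj]) (simp add: split_def)
  finally show ?thesis .
qed

text \<open>The two cover sums have the same value, so their coefficients \<open>2 - z\<close> and
  \<open>z\<close> add up to \<open>2\<close>. This is where \<open>z\<close> disappears.\<close>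

lemma sum_covers_bruhat_wt:
  assumes w: "w permutes {1..n}"
  shows "(\<Sum>(i, j)\<in>covers n w. bruhat_wt n (w, w \<circ> transpose i j) * of_int (schubert_one n (w \<circ> transpose i j))) =
    of_nat ((n choose 2) - inversions n w) * of_int (schubert_one n w)"
proof -
  let ?E = "\<Sum>(i, j)\<in>covers n w. (1 + 2 * int (exceed_between w i j)) * schubert_one n (w \<circ> transpose i j)"
  let ?C = "\<Sum>(i, j)\<in>covers n w. (1 + 2 * int (between_after n w i j)) * schubert_one n (w \<circ> transpose i j)"
  let ?R = "of_nat ((n choose 2) - inversions n w) * of_int (schubert_one n w) :: int poly"
  have "2 * (\<Sum>(i, j)\<in>covers n w. bruhat_wt n (w, w \<circ> transpose i j) * of_int (schubert_one n (w \<circ> transpose i j))) =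
      (\<Sum>(i, j)\<in>covers n w. 2 * bruhat_wt n (w, w \<circ> transpose i j) * of_int (schubert_one n (w \<circ> transpose i j)))"
    by (simp add: sum_distrib_left split_def mult.assoc)
  also have "\<dots> = (\<Sum>(i, j)\<in>covers n w. [:2, - 1:] * of_int ((1 + 2 * int (exceed_between w i j)) * schubert_one n (w \<circ> transpose i j)) +
      [:0, 1:] * of_int ((1 + 2 * int (between_after n w i j)) * schubert_one n (w \<circ> transpose i j)))"
  proof (rule sum.cong, rule refl, clarify)
    fix i j assume "(i, j) \<in> covers n w"
    then have "i < j" by (simp add: covers_def)
    show "2 * bruhat_wt n (w, w \<circ> transpose i j) * of_int (schubert_one n (w \<circ> transpose i j)) =
      [:2, - 1:] * of_int ((1 + 2 * int (exceed_between w i j)) * schubert_one n (w \<circ> transpose i j)) +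
      [:0, 1:] * of_int ((1 + 2 * int (between_after n w i j)) * schubert_one n (w \<circ> transpose i j))"
      unfolding bruhat_wt_transpose[OF w \<open>i < j\<close>] of_int_mult by (simp only: distrib_right mult.assoc)
  qed
  also have "\<dots> = [:2, - 1:] * of_int ?E + [:0, 1:] * of_int ?C"
    unfolding of_int_sum sum_distrib_left sum.distrib[symmetric] by (rule sum.cong) auto
  also have "\<dots> = ([:2, - 1:] + [:0, 1:]) * ?R"
    unfolding sum_covers_exceed_between[OF w] sum_covers_between_after[OF w]
    using inversions_le[of n w] by (simp only: distrib_right of_int_mult of_nat_diff of_int_diff of_int_of_nat_eq)
  also have "[:2, - 1:] + [:0, 1:] = (2 :: int poly)" by (simp add: numeral_poly)
  finally show ?thesis by (rule mult_left_cancel[THEN iffD1, rotated]) simp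
qed

text \<open>Induction on the colength. All covers have colength one less, so their factorial is a
  common factor, and the weighted cover sum supplies the next factor.\<close>

lemma chain_sum_longest:
  assumes "w permutes {1..n}"
  shows "chain_sum n (bruhat_wt n) w (longest_perm n) =
    fact ((n choose 2) - inversions n w) * of_int (schubert_one n w)"
  using assms
proof (induction "(n choose 2) - inversions n w" arbitrary: w rule: less_induct)
  case less
  note w = less.prems
  show ?case
  proof (cases "w = longest_perm n")
    case True
    then show ?thesis
      by (simp add: chain_sum_def saturated_chains_longest chain_weight_def inversions_longest schubert_one_longest)
  next
    case False
    then obtain d where d: "(n choose 2) - inversions n w = Suc d"
      using inversions_eq_choose_iff[OF w] inversions_le[of n w] by (cases "(n choose 2) - inversions n w") auto
    have IH: "chain_sum n (bruhat_wt n) (w \<circ> transpose i j) (longest_perm n) =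
        fact d * of_int (schubert_one n (w \<circ> transpose i j))" if e: "(i, j) \<in> covers n w" for i j
    proof -
      have ij: "1 \<le> i" "i < j" "j \<le> n" using e by (auto simp: covers_def)
      have wt: "w \<circ> transpose i j permutes {1..n}" using permutes_comp_transpose(1)[OF w] ij by simp
      have "(n choose 2) - inversions n (w \<circ> transpose i j) = d" using covers_iff[OF w ij] e d by simp
      then show ?thesis using less.hyps[OF _ wt] d by simp
    qed
    have "chain_sum n (bruhat_wt n) w (longest_perm n) = (\<Sum>(i, j)\<in>covers n w.
        bruhat_wt n (w, w \<circ> transpose i j) * (fact d * of_int (schubert_one n (w \<circ> transpose i j))))"
      unfolding chain_sum_step[OF w False] by (rule sum.cong) (auto simp: IH)
    also have "\<dots> = fact d * (\<Sum>(i, j)\<in>covers n w.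
        bruhat_wt n (w, w \<circ> transpose i j) * of_int (schubert_one n (w \<circ> transpose i j)))"
      by (simp add: sum_distrib_left split_def mult_ac)
    also have "\<dots> = fact ((n choose 2) - inversions n w) * of_int (schubert_one n w)"
      unfolding sum_covers_bruhat_wt[OF w] d by (simp only: fact_Suc mult_ac)
    finally show ?thesis .
  qed
qed

theorem theorem1p4:
  fixes n :: nat and w :: "nat \<Rightarrow> nat"
  assumes "n \<ge> 1" and "w permutes {1..n}"
  shows "chain_sum n (bruhat_wt n) w (longest_perm n) =
             fact ((n choose 2) - coxeter_length n w) *
               of_int (mpoly_subst (\<lambda>_. 1 :: int) (schubert n w)) \<and>
           degree (chain_sum n (bruhat_wt n) w (longest_perm n)) = 0"
proof
  show eq: "chain_sum n (bruhat_wt n) w (longest_perm n) =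
      fact ((n choose 2) - coxeter_length n w) * of_int (mpoly_subst (\<lambda>_. 1 :: int) (schubert n w))"
    using chain_sum_longest[OF assms(2)] coxeter_length_eq_inversions[OF assms(2)]
    by (simp add: schubert_one_def)
  \<comment> \<open>The value is an integer constant in \<open>int poly\<close>; independence of
    \<open>z\<close> is expressed by degree \<open>0\<close>.\<close>
  have "fact k * of_int c = (of_int (fact k * c) :: int poly)" for k c by simp
  then show "degree (chain_sum n (bruhat_wt n) w (longest_perm n)) = 0"
    unfolding eq by (simp only: degree_of_int)
qed

end
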